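(* Suppose that: (i) the problem $\min_{\theta\in\mathbb{R}^d}F(\theta)=\frac1m\sum_{i=1}^m f_i(\theta)$ has an optimal solution, $F$ is convex, and there is $L>0$ such that $\|\nabla f_i(u)-\nabla f_i(v)\|\le L\|u-v\|$ for all $i\in[m]$ and all $u,v\in\mathbb{R}^d$; (ii) the coupling matrix $W=\{w_{ij}\}\in\mathbb{R}^{m\times m}$ is symmetric and satisfies $\mathbf{1}^TW=\mathbf{0}^T$, $W\mathbf{1}=\mathbf{0}$, and $\|I+W-\frac{\mathbf{1}\mathbf{1}^T}{m}\|<1$; (iii) for every $i\in[m]$ and every $k\ge0$, conditional on the state $x_i^k$, the random noise $\zeta_i^k$ satisfies $\mathbb{E}[\zeta_i^k\mid x_i^k]=0$ and $\mathbb{E}[\|\zeta_i^k\|^2\mid x_i^k]=(\sigma_i^k)^2$; moreover $\sum_{k=0}^\infty(\gamma^k)^2\max_{i\in[m]}(\sigma_i^k)^2<\infty$, and the initial random vectors satisfy $\mathbb{E}[\|x_i^0\|^2]<\infty$ for all $i\in[m]$; (iv) the nonnegative sequences $\{\gamma^k\}$ and $\{\lambda^k\}$ satisfy $\sum_{k=0}^\infty\gamma^k=\infty$, $\sum_{k=0}^\infty\lambda^k=\infty$, and $\sum_{k=0}^\infty\frac{(\lambda^k)^2}{\gamma^k}<\infty$. Then Algorithm 1 converges almost surely to a solution of the problem; that is, almost surely there is an optimal solution $\tilde\theta^*$ of $\min_\theta F(\theta)$ such that $\lim_{k\to\infty}x_i^k=\tilde\theta^*$ for all $i\in[m]$.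
   Context: There are $m$ agents, $[m]=\{1,\dots,m\}$; agent $i$ has a private differentiable function $f_i:\mathbb{R}^d\to\mathbb{R}$. The matrix $W=\{w_{ij}\}$ has $w_{ij}>0$ for $i\ne j$ if there is a link from agent $j$ to agent $i$, $w_{ij}=0$ for $i\neq j$ otherwise, and $w_{ii}=-\sum_{j\in\mathbb{N}_i^{\rm in}}w_{ij}$, where $\mathbb{N}_i^{\rm in}=\{j\neq i: w_{ij}>0\}$ is the in-neighbor set. $\mathbf{1}$ is the all-ones vector and $\|\cdot\|$ on matrices is the induced Euclidean norm. Algorithm 1 (static-consensus method): parameters are the stepsizes $\lambda^k$ and the weakening factors $\gamma^k$, where $\gamma^k>0$ and $\{\gamma^k\}$ diminishes with time (decreases to zero). Every agent $i$ maintains a state $x_i^k\in\mathbb{R}^d$, initialized with a random vector $x_i^0\in\mathbb{R}^d$. At each iteration $k=0,1,2,\dots$, every agent $j$ sends $x_j^k+\zeta_j^k$ to its out-neighbors, where $\zeta_j^k\in\mathbb{R}^d$ is random noise, and every agent $i$ updates $$x_i^{k+1}=x_i^k+\sum_{j\in\mathbb{N}_i^{\rm in}}\gamma^kw_{ij}(x_j^k+\zeta_j^k-x_i^k)-\lambda^k\nabla f_i(x_i^k).$$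
   Formalization: The formal theorem adds to (iii) that the conditional mean of the noise given all agents' states up to time k equals its conditional mean given x_i^k (so it is zero); with conditioning on x_i^k alone the claim is false. *)

theory Defs
  imports "HOL-Probability.Probability"
begin

definition objective :: "('m::finite \<Rightarrow> 'a \<Rightarrow> real) \<Rightarrow> 'a \<Rightarrow> real" where
  "objective f \<theta> = (\<Sum>i\<in>UNIV. f i \<theta>) / real CARD('m)"

definition optimal_solution :: "('a \<Rightarrow> real) \<Rightarrow> 'a \<Rightarrow> bool" where
  "optimal_solution F \<theta> \<longleftrightarrow> is_arg_min F (\<lambda>_. True) \<theta>"

definition in_nbrs :: "real ^ 'm ^ 'm \<Rightarrow> 'm \<Rightarrow> 'm set" where
  "in_nbrs W i = {j. j \<noteq> i \<and> W $ i $ j > 0}"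

definition coupling_matrix :: "real ^ 'm ^ 'm \<Rightarrow> bool" where
  "coupling_matrix W \<longleftrightarrow>
     (\<forall>i j. i \<noteq> j \<longrightarrow> W $ i $ j \<ge> 0) \<and>
     (\<forall>i. W $ i $ i = - (\<Sum>j\<in>in_nbrs W i. W $ i $ j))"

definition avg_matrix :: "real ^ 'm ^ 'm" where
  "avg_matrix = (\<chi> i j. 1 / real CARD('m))"

text \<open>
  The state \<open>x k i \<omega>\<close> of agent \<open>i\<close> after \<open>k\<close> iterations. The initial states \<open>x 0 i\<close> are
  unconstrained here; \<open>g i\<close> is the gradient of the private function of agent \<open>i\<close>.
\<close>

definition static_consensus ::
  "'w measure \<Rightarrow> real ^ 'm ^ 'm \<Rightarrow> (nat \<Rightarrow> real) \<Rightarrow> (nat \<Rightarrow> real) \<Rightarrow>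
   ('m::finite \<Rightarrow> real ^ 'd \<Rightarrow> real ^ 'd) \<Rightarrow>
   (nat \<Rightarrow> 'm \<Rightarrow> 'w \<Rightarrow> real ^ 'd) \<Rightarrow> (nat \<Rightarrow> 'm \<Rightarrow> 'w \<Rightarrow> real ^ 'd) \<Rightarrow> bool" where
  "static_consensus M W \<gamma> lam g \<zeta> x \<longleftrightarrow>
     (\<forall>k i. \<forall>\<omega>\<in>space M.
        x (Suc k) i \<omega> =
          x k i \<omega>
          + (\<Sum>j\<in>in_nbrs W i. (\<gamma> k * W $ i $ j) *\<^sub>R (x k j \<omega> + \<zeta> k j \<omega> - x k i \<omega>))
          - lam k *\<^sub>R g i (x k i \<omega>))"

definition state_algebra :: "'w measure \<Rightarrow> ('w \<Rightarrow> 'a::topological_space) \<Rightarrow> 'w measure" where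
  "state_algebra M X = vimage_algebra (space M) X borel"

definition history_algebra ::
  "'w measure \<Rightarrow> (nat \<Rightarrow> 'm \<Rightarrow> 'w \<Rightarrow> 'a::topological_space) \<Rightarrow> nat \<Rightarrow> 'w measure" where
  "history_algebra M x k =
     sigma (space M) (\<Union>l\<in>{..k}. \<Union>i. sets (state_algebra M (x l i)))"

text \<open>
  The library's conditional expectation is real-valued, so it is taken componentwise. Its value
  is only meaningful for integrable arguments.
\<close>

definition vec_cond_exp :: "'w measure \<Rightarrow> 'w measure \<Rightarrow> ('w \<Rightarrow> real ^ 'd) \<Rightarrow> 'w \<Rightarrow> real ^ 'd" where
  "vec_cond_exp M G Z \<omega> = (\<chi> c. real_cond_exp M G (\<lambda>\<omega>. Z \<omega> $ c) \<omega>)"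

text \<open>
  Zero mean and variance \<open>(\<sigma> k i)\<^sup>2\<close> of the noise, conditional on the current state of the
  agent. The second condition uses the conditional expectation with values in \<open>[0, \<infinity>]\<close>, so on
  a probability space it entails that the noise is square integrable, hence integrable.
\<close>

definition noise_moments ::
  "'w measure \<Rightarrow> (nat \<Rightarrow> 'm \<Rightarrow> 'w \<Rightarrow> real ^ 'd) \<Rightarrow> (nat \<Rightarrow> 'm \<Rightarrow> 'w \<Rightarrow> real ^ 'd) \<Rightarrow>
   (nat \<Rightarrow> 'm \<Rightarrow> real) \<Rightarrow> bool" where
  "noise_moments M x \<zeta> \<sigma> \<longleftrightarrow>
     (\<forall>k i. \<zeta> k i \<in> borel_measurable M \<and>
        (AE \<omega> in M. vec_cond_exp M (state_algebra M (x k i)) (\<zeta> k i) \<omega> = 0) \<and>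
        (AE \<omega> in M. nn_cond_exp M (state_algebra M (x k i))
            (\<lambda>\<omega>. ennreal ((norm (\<zeta> k i \<omega>))\<^sup>2)) \<omega> = ennreal ((\<sigma> k i)\<^sup>2)))"

text \<open>
  The current state of an agent carries all the information that the states of all agents up to
  the present carry about the mean of its next noise. This is the sense in which the noise is
  specified conditional on the state. Zero mean given \<open>x k i\<close> alone would leave the noise free to
  be correlated with the earlier noise: already for two agents with zero objectives and equal
  noise, the common state need not converge, since \<open>E[X\<^bsub>k+1\<^esub> | X\<^bsub>k\<^esub>] = X\<^bsub>k\<^esub>\<close> does not make
  \<open>X\<close> a martingale.
\<close>

definition noise_memoryless ::
  "'w measure \<Rightarrow> (nat \<Rightarrow> 'm \<Rightarrow> 'w \<Rightarrow> real ^ 'd) \<Rightarrow> (nat \<Rightarrow> 'm \<Rightarrow> 'w \<Rightarrow> real ^ 'd) \<Rightarrow> bool" where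
  "noise_memoryless M x \<zeta> \<longleftrightarrow>
     (\<forall>k i. AE \<omega> in M. vec_cond_exp M (history_algebra M x k) (\<zeta> k i) \<omega> =
                       vec_cond_exp M (state_algebra M (x k i)) (\<zeta> k i) \<omega>)"

end

theory Submission
  imports Defs
begin

text \<open>
  Let \<open>z\<close> be the mean of the states, \<open>V\<close> the sum of their squared distances to \<open>z\<close>, and
  \<open>D = |z - \<theta>|\<^sup>2\<close> for an optimal \<open>\<theta>\<close>. Write \<open>c > 0\<close> for the spectral gap and \<open>r = lam\<^sup>2 / \<gamma>\<close>,
  which is summable. Up to terms that the noise makes centered or summable, once \<open>\<gamma> \<le> 1\<close>,
  one iteration turns \<open>V\<close> into at most \<open>(1 - c \<gamma>) V + C r (1 + V + D)\<close> and \<open>D\<close> into at most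
  \<open>D - 2 lam (F z - F \<theta>) + c \<gamma> V / 2 + C r (1 + V + D)\<close>. Adding the two in expectation bounds
  \<open>E V + E D\<close> and makes \<open>\<gamma> E V\<close> and \<open>lam E (F z - F \<theta>)\<close> summable. Hence \<open>V\<close> and \<open>D\<close> are,
  each on its own, supermartingales up to a summable error and converge almost surely by an
  upcrossing argument. Since neither \<open>\<gamma>\<close> nor \<open>lam\<close> is summable, \<open>V\<close> tends to \<open>0\<close> and \<open>F z\<close> comes
  arbitrarily close to the minimum, so some subsequence of \<open>z\<close> tends to a minimiser, and the
  convergence of \<open>|z - \<theta>|\<close> for a dense set of minimisers \<open>\<theta>\<close> makes all of \<open>z\<close> follow.
\<close>

subsection \<open>Convergence of almost supermartingales\<close>

text \<open>The obstacle is that consensus and optimisation feed each other. The mean moves along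
  gradients taken at the individual states, and these differ from the gradients at z by an amount
  proportional to the spread. So D receives a cross term of order lam |z - \<theta>| sqrt V. Young's
  inequality trades it for c \<gamma> V / 2, half of what the contraction of V removes, plus a
  multiple of (lam^2 / \<gamma>) D. Conversely, V is driven by gradients whose size grows with both
  V and D, and dividing lam^2 by the contraction rate c \<gamma> again produces the ratio r. Neither
  process has a closed inequality at first. Taking expectations of the sum closes the loop and turns
  the random errors into numbers. This is why a deterministic error sequence \<open>b\<close>
  suffices in \<open>almost_supermartingale\<close>, and why the bounds in expectation must precede
  every almost sure statement. The finitely many iterations with \<gamma> > 1 are cut off by an
  index shift \<open>K\<close>.\<close>

lemma AE_summable_if_summable_integral:
  fixes f :: "nat \<Rightarrow> 'w \<Rightarrow> real"
  assumes int: "\<And>k. integrable M (f k)"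
    and nonneg: "\<And>k \<omega>. \<omega> \<in> space M \<Longrightarrow> 0 \<le> f k \<omega>"
    and sum: "summable (\<lambda>k. \<integral>\<omega>. f k \<omega> \<partial>M)"
  shows "AE \<omega> in M. summable (\<lambda>k. f k \<omega>)"
proof -
  have [measurable]: "f k \<in> borel_measurable M" for k
    using int by auto
  have "(\<integral>\<^sup>+\<omega>. (\<Sum>k. ennreal (f k \<omega>)) \<partial>M) = (\<Sum>k. \<integral>\<^sup>+\<omega>. ennreal (f k \<omega>) \<partial>M)"
    by (intro nn_integral_suminf) auto
  also have "\<dots> = (\<Sum>k. ennreal (\<integral>\<omega>. f k \<omega> \<partial>M))"
    by (intro suminf_cong nn_integral_eq_integral int AE_I2 nonneg)
  also have "\<dots> < \<infinity>"
    using sum by (subst suminf_ennreal2) (auto intro!: integral_nonneg_AE AE_I2 nonneg)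
  finally have "AE \<omega> in M. (\<Sum>k. ennreal (f k \<omega>)) \<noteq> \<infinity>"
    by (intro nn_integral_PInf_AE) auto
  then show ?thesis
    using AE_space
  proof eventually_elim
    case (elim \<omega>)
    then show ?case by (intro summable_suminf_not_top nonneg) auto
  qed
qed

text \<open>\<open>freq\<close> and \<open>osc\<close> together bound the sequence, so it has a
  cluster point, and \<open>osc\<close> then forbids infinitely many excursions away from that
  point. Only rational thresholds are asked for, so that countably many null sets suffice in the
  application.\<close>

lemma convergent_if_no_oscillation:
  fixes y :: "nat \<Rightarrow> real"
  assumes nonneg: "\<And>k. 0 \<le> y k"
    and freq: "\<exists>\<^sub>F k in sequentially. y k < C"
    and osc: "\<And>a b. a \<in> \<rat> \<Longrightarrow> b \<in> \<rat> \<Longrightarrow> a < b \<Longrightarrow> 0 \<le> a \<Longrightarrow>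
      \<exists>\<^sub>F k in sequentially. y k < a \<Longrightarrow> \<forall>\<^sub>F k in sequentially. y k \<le> b"
  shows "convergent y"
proof -
  \<comment> \<open>Rationals strictly between \<open>s\<close> and \<open>t\<close> carry
    \<open>osc\<close> over to real thresholds. Some value of \<open>y\<close> lies below
    \<open>a\<close>, which makes \<open>a\<close> nonnegative.\<close>
  have upper: "\<forall>\<^sub>F k in sequentially. y k \<le> t"
    if below: "\<exists>\<^sub>F k in sequentially. y k < s" and st: "s < t" for s t
  proof -
    obtain a where a: "a \<in> \<rat>" "s < a" "a < t"
      using Rats_dense_in_real[OF st] by blast
    obtain b where b: "b \<in> \<rat>" "a < b" "b < t"
      using Rats_dense_in_real[OF a(3)] by blast
    obtain k where "y k < s"
      using below by (auto dest: frequently_ex)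
    then have "0 \<le> a"
      using nonneg[of k] a by linarith
    moreover have "\<exists>\<^sub>F k in sequentially. y k < a"
      using below by (rule frequently_elim1) (use a in simp)
    ultimately have "\<forall>\<^sub>F k in sequentially. y k \<le> b"
      using osc a b by blast
    then show ?thesis
      by eventually_elim (use b in simp)
  qed
  have "\<forall>\<^sub>F k in sequentially. y k \<le> C + 1"
    using upper freq by simp
  then obtain N where N: "\<And>k. k \<ge> N \<Longrightarrow> y k \<le> C + 1"
    unfolding eventually_sequentially by blast
  have "\<forall>k. y (k + N) \<in> {0..C + 1}"
    using N nonneg by simp
  then obtain l r where r: "strict_mono r" and lim: "((\<lambda>k. y (k + N)) \<circ> r) \<longlonglongrightarrow> l"
    using compact_Icc[of 0 "C + 1"] unfolding compact_def by metis
  define s where "s k = r k + N" for k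
  have s: "strict_mono s" and lim: "(\<lambda>k. y (s k)) \<longlonglongrightarrow> l"
    using r lim by (auto simp: s_def strict_mono_def o_def)
  have freq_near: "\<exists>\<^sub>F k in sequentially. P (y k)" if "\<forall>\<^sub>F k in sequentially. P (y (s k))" for P
    unfolding frequently_sequentially
  proof
    fix K
    have "\<forall>\<^sub>F k in sequentially. P (y (s k)) \<and> k \<ge> K"
      using that eventually_ge_at_top by (rule eventually_conj)
    then obtain k where "P (y (s k))" "k \<ge> K"
      by (auto simp: eventually_sequentially)
    then show "\<exists>n\<ge>K. P (y n)"
      using seq_suble[OF s, of k] le_trans by blast
  qed
  have "y \<longlonglongrightarrow> l"
  proof (rule order_tendstoI)
    fix a assume "a < l"
    then have "\<exists>\<^sub>F k in sequentially. (a + l) / 2 < y k"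
      by (intro freq_near order_tendstoD(1)[OF lim]) simp
    \<comment> \<open>The threshold \<open>(2 * a + l) / 3\<close> lies strictly between
      \<open>a\<close> and \<open>(a + l) / 2\<close>. Falling below it again and again would by
      \<open>upper\<close> keep \<open>y\<close> eventually at most \<open>(a + l) / 2\<close>,
      against the cluster point \<open>l\<close>.\<close>
    then have "\<not> (\<exists>\<^sub>F k in sequentially. y k < (2 * a + l) / 3)"
      using upper[of "(2 * a + l) / 3" "(a + l) / 2"] \<open>a < l\<close>
      by (auto simp: frequently_def not_less)
    then have "\<forall>\<^sub>F k in sequentially. (2 * a + l) / 3 \<le> y k"
      by (simp add: frequently_def not_less)
    then show "\<forall>\<^sub>F k in sequentially. a < y k"
      by eventually_elim (use \<open>a < l\<close> in simp)
  next
    fix a assume "l < a"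
    then have "\<exists>\<^sub>F k in sequentially. y k < (l + a) / 2"
      by (intro freq_near order_tendstoD(2)[OF lim]) simp
    then have "\<forall>\<^sub>F k in sequentially. y k \<le> (l + 2 * a) / 3"
      by (rule upper) (use \<open>l < a\<close> in simp)
    then show "\<forall>\<^sub>F k in sequentially. y k < a"
      by eventually_elim (use \<open>l < a\<close> in simp)
  qed
  then show ?thesis
    by (rule convergentI)
qed

text \<open>The state of a trader who buys below \<open>a\<close> and sells above \<open>b\<close>.\<close>

primrec crossing :: "real \<Rightarrow> real \<Rightarrow> (nat \<Rightarrow> real) \<Rightarrow> nat \<Rightarrow> bool" where
  "crossing a b y 0 \<longleftrightarrow> y 0 < a"
| "crossing a b y (Suc k) \<longleftrightarrow> (if crossing a b y k then y (Suc k) \<le> b else y (Suc k) < a)"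

text \<open>The right side is the trader's profit, where \<open>crossing\<close> at \<open>k\<close>
  means a position held from \<open>k\<close> to \<open>k + 1\<close>. Each completed sale earns at
  least \<open>b - a\<close>. An open position was bought below \<open>a\<close>, so valuing its
  gain at \<open>y n - a\<close> underestimates it.\<close>

lemma crossing_gain:
  assumes "a < b"
  shows "(b - a) * (\<Sum>k<n. of_bool (crossing a b y k \<and> \<not> crossing a b y (Suc k)))
      + (if crossing a b y n then y n - a else 0)
    \<le> (\<Sum>k<n. of_bool (crossing a b y k) * (y (Suc k) - y k))"
proof (induction n)
  case 0
  then show ?case by auto
next
  case (Suc n)
  define S where "S n = (\<Sum>k<n. of_bool (crossing a b y k \<and> \<not> crossing a b y (Suc k)) :: real)" for n
  define G where "G n = (\<Sum>k<n. of_bool (crossing a b y k) * (y (Suc k) - y k))" for n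
  have S: "S (Suc n) = S n + of_bool (crossing a b y n \<and> \<not> crossing a b y (Suc n))"
    and G: "G (Suc n) = G n + of_bool (crossing a b y n) * (y (Suc n) - y n)"
    by (simp_all only: S_def G_def sum.lessThan_Suc)
  show ?case
    using Suc assms unfolding S_def[symmetric] G_def[symmetric] S G
    by (auto simp: algebra_simps)
qed

text \<open>Once no further sale takes place, a dip below \<open>a\<close> leaves a position that is
  never closed, and an open position keeps \<open>y\<close> at most \<open>b\<close>.\<close>

lemma no_oscillation_if_finitely_many_crossings:
  assumes "a < b"
    and fin: "summable (\<lambda>k. of_bool (crossing a b y k \<and> \<not> crossing a b y (Suc k)) :: real)"
    and freq: "\<exists>\<^sub>F k in sequentially. y k < a"
  shows "\<forall>\<^sub>F k in sequentially. y k \<le> b"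
proof -
  \<comment> \<open>The summands are 0 or 1, so tending to 0 means vanishing eventually.\<close>
  have "\<forall>\<^sub>F k in sequentially. (of_bool (crossing a b y k \<and> \<not> crossing a b y (Suc k)) :: real) < 1"
    using summable_LIMSEQ_zero[OF fin] by (rule order_tendstoD) simp
  then obtain K where K: "\<And>k. k \<ge> K \<Longrightarrow> crossing a b y k \<Longrightarrow> crossing a b y (Suc k)"
    unfolding eventually_sequentially by auto
  obtain k where k: "k \<ge> K" "y k < a"
    using freq unfolding frequently_sequentially by blast
  have start: "crossing a b y k"
    using k(2) assms(1) by (cases k) auto
  have stay: "crossing a b y (k + n)" for n
    by (induction n) (use start K k in auto)
  have "y j \<le> b" if "j > k" for j
  proof -
    obtain n where "j = Suc (k + n)"
      using less_imp_Suc_add[OF \<open>j > k\<close>] by blast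
    then show ?thesis
      using stay[of n] stay[of "Suc n"] by auto
  qed
  then show ?thesis
    using eventually_gt_at_top[of k] by (metis (mono_tags, lifting) eventually_mono)
qed

text \<open>Testing the increments on the events of the filtration replaces conditional expectations,
  and is all that the upcrossing inequality needs.\<close>

locale almost_supermartingale = prob_space M for M :: "'w measure" +
  fixes F :: "nat \<Rightarrow> 'w measure" and Y :: "nat \<Rightarrow> 'w \<Rightarrow> real" and b :: "nat \<Rightarrow> real"
  assumes subalg: "\<And>k. subalgebra M (F k)"
    and filtration: "\<And>k. sets (F k) \<subseteq> sets (F (Suc k))"
    and adapted: "\<And>k. Y k \<in> borel_measurable (F k)"
    and integrable: "\<And>k. integrable M (Y k)"
    and nonneg: "\<And>k \<omega>. \<omega> \<in> space M \<Longrightarrow> 0 \<le> Y k \<omega>"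
    and drift: "\<And>k A. A \<in> sets (F k) \<Longrightarrow>
      (\<integral>\<omega>. indicator A \<omega> * (Y (Suc k) \<omega> - Y k \<omega>) \<partial>M) \<le> b k"
    and summable_b: "summable b"
begin

lemma b_nonneg: "0 \<le> b k"
  using drift[of "{}" k] by simp

lemma expectation_bound: "expectation (Y n) \<le> expectation (Y 0) + suminf b"
proof -
  have step: "expectation (Y (Suc k)) \<le> expectation (Y k) + b k" for k
  proof -
    have "space M \<in> sets (F k)"
      using subalg[of k] by (metis sets.top subalgebra_def)
    from drift[OF this] have "(\<integral>\<omega>. Y (Suc k) \<omega> - Y k \<omega> \<partial>M) \<le> b k"
      by (simp cong: Bochner_Integration.integral_cong)
    then show ?thesis
      using integrable by simp
  qed
  have "expectation (Y n) \<le> expectation (Y 0) + sum b {..<n}"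
  proof (induction n)
    case (Suc n)
    then show ?case using step[of n] by simp
  qed simp
  then show ?thesis
    using sum_le_suminf[OF summable_b, of "{..<n}"] b_nonneg by simp
qed

text \<open>Fatou's lemma bounds the integral of the lower limit, which is therefore finite almost
  everywhere. This bounds the path only infinitely often; the finiteness of the crossings does the
  rest.\<close>

lemma AE_frequently_bounded: "AE \<omega> in M. \<exists>C. \<exists>\<^sub>F k in sequentially. Y k \<omega> < C"
proof -
  define B where "B = ennreal (expectation (Y 0) + suminf b)"
  have [measurable]: "Y k \<in> borel_measurable M" for k
    using integrable by auto
  have "(\<integral>\<^sup>+\<omega>. liminf (\<lambda>k. ennreal (Y k \<omega>)) \<partial>M) \<le> liminf (\<lambda>k. \<integral>\<^sup>+\<omega>. ennreal (Y k \<omega>) \<partial>M)"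
    by (intro nn_integral_liminf) auto
  also have "(\<lambda>k. \<integral>\<^sup>+\<omega>. ennreal (Y k \<omega>) \<partial>M) = (\<lambda>k. ennreal (expectation (Y k)))"
    by (intro ext nn_integral_eq_integral integrable AE_I2 nonneg)
  also have "liminf \<dots> \<le> limsup \<dots>"
    by (rule Liminf_le_Limsup) simp
  also have "\<dots> \<le> B"
    unfolding B_def by (intro Limsup_bounded always_eventually allI ennreal_leI expectation_bound)
  also have "B < \<infinity>"
    by (simp add: B_def)
  finally have "AE \<omega> in M. liminf (\<lambda>k. ennreal (Y k \<omega>)) \<noteq> \<infinity>"
    by (intro nn_integral_PInf_AE) auto
  then show ?thesis
    using AE_space
  proof eventually_elim
    case (elim \<omega>)
    obtain c where c: "liminf (\<lambda>k. ennreal (Y k \<omega>)) = ennreal c" "0 \<le> c"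
      using elim(1) by (cases "liminf (\<lambda>k. ennreal (Y k \<omega>))") auto
    have "\<exists>\<^sub>F k in sequentially. Y k \<omega> < c + 1"
    proof (rule ccontr)
      assume "\<not> ?thesis"
      then have "\<forall>\<^sub>F k in sequentially. c + 1 \<le> Y k \<omega>"
        by (simp add: frequently_def not_less)
      then have "\<forall>\<^sub>F k in sequentially. ennreal (c + 1) \<le> ennreal (Y k \<omega>)"
        by eventually_elim (rule ennreal_leI)
      then have "ennreal (c + 1) \<le> liminf (\<lambda>k. ennreal (Y k \<omega>))"
        by (rule Liminf_bounded)
      with c show False by simp
    qed
    then show ?case by blast
  qed
qed

text \<open>Whether a position is held from \<open>n\<close> to \<open>n + 1\<close> is decided by
  the values up to \<open>n\<close>. This makes it an event to which \<open>drift\<close>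
  applies.\<close>

lemma crossing_measurable:
  "{\<omega> \<in> space M. crossing a c (\<lambda>k. Y k \<omega>) n} \<in> sets (F n)"
proof (induction n)
  case 0
  have [measurable]: "Y 0 \<in> borel_measurable (F 0)" by (rule adapted)
  have "{\<omega> \<in> space (F 0). Y 0 \<omega> < a} \<in> sets (F 0)" by measurable
  moreover have "space (F 0) = space M" using subalg[of 0] by (simp add: subalgebra_def)
  ultimately show ?case by simp
next
  case (Suc n)
  have [measurable]: "Y (Suc n) \<in> borel_measurable (F (Suc n))" by (rule adapted)
  have sp: "space (F (Suc n)) = space M" using subalg[of "Suc n"] by (simp add: subalgebra_def)
  have [measurable]: "{\<omega> \<in> space M. crossing a c (\<lambda>k. Y k \<omega>) n} \<in> sets (F (Suc n))"
    using Suc filtration by blast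
  have "{\<omega> \<in> space (F (Suc n)). if \<omega> \<in> {\<omega> \<in> space M. crossing a c (\<lambda>k. Y k \<omega>) n}
      then Y (Suc n) \<omega> \<le> c else Y (Suc n) \<omega> < a} \<in> sets (F (Suc n))"
    by measurable
  moreover have "{\<omega> \<in> space (F (Suc n)). if \<omega> \<in> {\<omega> \<in> space M. crossing a c (\<lambda>k. Y k \<omega>) n}
      then Y (Suc n) \<omega> \<le> c else Y (Suc n) \<omega> < a}
    = {\<omega> \<in> space M. crossing a c (\<lambda>k. Y k \<omega>) (Suc n)}"
    unfolding sp by auto
  ultimately show ?case by simp
qed

text \<open>Doob's upcrossing argument. The expected profit of the trader is at most the sum of the
  drift bounds, while every sale brings at least \<open>c - a\<close>. Hence the expected number of
  sales is at most \<open>(a + suminf b) / (c - a)\<close>, uniformly in the horizon.\<close>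

lemma AE_finitely_many_crossings:
  assumes "a < c" "0 \<le> a"
  shows "AE \<omega> in M. summable (\<lambda>k. of_bool (crossing a c (\<lambda>k. Y k \<omega>) k
    \<and> \<not> crossing a c (\<lambda>k. Y k \<omega>) (Suc k)) :: real)"
proof -
  let ?H = "\<lambda>k. {\<omega> \<in> space M. crossing a c (\<lambda>k. Y k \<omega>) k}"
  define up where "up k = ?H k - ?H (Suc k)" for k
  have H_sets [measurable]: "?H k \<in> sets M" for k
    using crossing_measurable[of a c k] subalg[of k] by (auto simp: subalgebra_def)
  have up_sets [measurable]: "up k \<in> sets M" for k
    unfolding up_def by (intro sets.Diff H_sets)
  have int_up: "Bochner_Integration.integrable M (indicator (up k) :: 'w \<Rightarrow> real)" for k
    by (simp add: emeasure_eq_measure)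
  have int_gain: "Bochner_Integration.integrable M (\<lambda>\<omega>. indicator (?H k) \<omega> * (Y (Suc k) \<omega> - Y k \<omega>))" for k
    using integrable_real_mult_indicator[OF H_sets Bochner_Integration.integrable_diff[OF integrable integrable]]
    by (simp add: mult.commute)
  have bound: "(\<Sum>k<n. expectation (indicator (up k))) \<le> (a + suminf b) / (c - a)" for n
  proof -
    have "(c - a) * (\<Sum>k<n. expectation (indicator (up k))) - a
        = expectation (\<lambda>\<omega>. (c - a) * (\<Sum>k<n. indicator (up k) \<omega>) - a)"
      using int_up prob_space by (simp add: Bochner_Integration.integral_sum)
    also have "\<dots> \<le> expectation (\<lambda>\<omega>. \<Sum>k<n. indicator (?H k) \<omega> * (Y (Suc k) \<omega> - Y k \<omega>))"
    proof (rule integral_mono)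
      show "Bochner_Integration.integrable M (\<lambda>\<omega>. (c - a) * (\<Sum>k<n. indicator (up k) \<omega>) - a)"
        using int_up by (intro Bochner_Integration.integrable_diff integrable_mult_right
            Bochner_Integration.integrable_sum) auto
      show "Bochner_Integration.integrable M (\<lambda>\<omega>. \<Sum>k<n. indicator (?H k) \<omega> * (Y (Suc k) \<omega> - Y k \<omega>))"
        by (intro Bochner_Integration.integrable_sum int_gain)
      fix \<omega> assume \<omega>: "\<omega> \<in> space M"
      have "(c - a) * (\<Sum>k<n. indicator (up k) \<omega>) - a
          = (c - a) * (\<Sum>k<n. of_bool (crossing a c (\<lambda>k. Y k \<omega>) k
            \<and> \<not> crossing a c (\<lambda>k. Y k \<omega>) (Suc k))) - a"
        using \<omega> by (simp add: up_def indicator_def of_bool_def)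
      \<comment> \<open>Since \<open>Y\<close> is nonnegative and \<open>0 \<le> a\<close>, an open
        position costs at most \<open>a\<close>.\<close>
      also have "\<dots> \<le> (c - a) * (\<Sum>k<n. of_bool (crossing a c (\<lambda>k. Y k \<omega>) k
            \<and> \<not> crossing a c (\<lambda>k. Y k \<omega>) (Suc k)))
          + (if crossing a c (\<lambda>k. Y k \<omega>) n then Y n \<omega> - a else 0)"
        using nonneg[OF \<omega>, of n] assms by simp
      also have "\<dots> \<le> (\<Sum>k<n. of_bool (crossing a c (\<lambda>k. Y k \<omega>) k) * (Y (Suc k) \<omega> - Y k \<omega>))"
        by (rule crossing_gain[OF assms(1)])
      also have "\<dots> = (\<Sum>k<n. indicator (?H k) \<omega> * (Y (Suc k) \<omega> - Y k \<omega>))"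
        using \<omega> by (simp add: indicator_def of_bool_def)
      finally show "(c - a) * (\<Sum>k<n. indicator (up k) \<omega>) - a
        \<le> (\<Sum>k<n. indicator (?H k) \<omega> * (Y (Suc k) \<omega> - Y k \<omega>))" .
    qed
    also have "\<dots> = (\<Sum>k<n. expectation (\<lambda>\<omega>. indicator (?H k) \<omega> * (Y (Suc k) \<omega> - Y k \<omega>)))"
      by (intro Bochner_Integration.integral_sum int_gain)
    also have "\<dots> \<le> (\<Sum>k<n. b k)"
      by (intro sum_mono drift crossing_measurable)
    also have "\<dots> \<le> suminf b"
      by (intro sum_le_suminf summable_b) (auto intro: b_nonneg)
    finally show ?thesis
      using assms by (simp add: pos_le_divide_eq algebra_simps)
  qed
  have "summable (\<lambda>k. expectation (indicator (up k)) :: real)"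
    by (rule summableI_nonneg_bounded[OF _ bound]) simp
  then have "AE \<omega> in M. summable (\<lambda>k. indicator (up k) \<omega> :: real)"
    by (intro AE_summable_if_summable_integral int_up) auto
  then show ?thesis
    using AE_space
  proof eventually_elim
    case (elim \<omega>)
    then show ?case by (simp add: up_def indicator_def of_bool_def)
  qed
qed

lemma AE_convergent: "AE \<omega> in M. convergent (\<lambda>k. Y k \<omega>)"
proof -
  have "AE \<omega> in M. \<forall>a\<in>\<rat>. \<forall>c\<in>\<rat>. a < c \<longrightarrow> 0 \<le> a \<longrightarrow>
      summable (\<lambda>k. of_bool (crossing a c (\<lambda>k. Y k \<omega>) k
        \<and> \<not> crossing a c (\<lambda>k. Y k \<omega>) (Suc k)) :: real)"
    by (intro AE_ball_countable[THEN iffD2] ballI countable_rat AE_impI AE_finitely_many_crossings)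
  with AE_frequently_bounded AE_space show ?thesis
  proof eventually_elim
    case (elim \<omega>)
    then obtain C where "\<exists>\<^sub>F k in sequentially. Y k \<omega> < C" by blast
    then show ?case
    proof (rule convergent_if_no_oscillation[rotated])
      show "0 \<le> Y k \<omega>" for k
        using elim(2) by (rule nonneg)
      show "\<forall>\<^sub>F k in sequentially. Y k \<omega> \<le> c"
        if "a \<in> \<rat>" "c \<in> \<rat>" "a < c" "0 \<le> a" "\<exists>\<^sub>F k in sequentially. Y k \<omega> < a" for a c
        using elim(3) that by (intro no_oscillation_if_finitely_many_crossings[of a c]) auto
    qed
  qed
qed

end

subsection \<open>Deterministic estimates\<close>

text \<open>A deterministic Robbins-Siegmund lemma. The factors \<open>1 + a k\<close> are at most
  \<open>exp (a k)\<close>, so their products stay bounded and \<open>u\<close> with them. Once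
  \<open>u\<close> is bounded, the multiplicative error becomes an additive one, and telescoping
  bounds the partial sums of \<open>w\<close>.\<close>

lemma summable_almost_decreasing:
  fixes u w a b :: "nat \<Rightarrow> real"
  assumes u: "\<And>k. 0 \<le> u k" and w: "\<And>k. 0 \<le> w k" and a: "\<And>k. 0 \<le> a k" and b: "\<And>k. 0 \<le> b k"
    and "summable a" "summable b"
    and step: "\<And>k. u (Suc k) + w k \<le> (1 + a k) * u k + b k"
  shows "\<exists>B. \<forall>k. u k \<le> B" "summable w"
proof -
  define B where "B = exp (suminf a) * (u 0 + suminf b)"
  have le: "u n \<le> exp (sum a {..<n}) * (u 0 + sum b {..<n})" for n
  proof (induction n)
    case (Suc n)
    have pos: "0 \<le> u 0 + sum b {..<n}"
      using u b by (simp add: sum_nonneg)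
    have "u (Suc n) \<le> (1 + a n) * u n + b n"
      using step[of n] w[of n] by linarith
    \<comment> \<open>The factor put on \<open>b n\<close> is at least 1; it lets both summands
      share \<open>exp (sum a {..<Suc n})\<close>.\<close>
    also have "\<dots> \<le> exp (a n) * (exp (sum a {..<n}) * (u 0 + sum b {..<n})) + exp (a n + sum a {..<n}) * b n"
    proof (intro add_mono mult_mono)
      show "1 + a n \<le> exp (a n)" by (rule exp_ge_add_one_self)
      have "1 * b n \<le> exp (a n + sum a {..<n}) * b n"
        using a b by (intro mult_right_mono) (auto intro!: add_nonneg_nonneg sum_nonneg)
      then show "b n \<le> exp (a n + sum a {..<n}) * b n" by simp
    qed (use Suc u a pos in auto)
    finally show ?case
      by (simp add: exp_add algebra_simps)
  qed (use u in simp)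
  have bound: "u n \<le> B" for n
  proof (rule order_trans[OF le])
    show "exp (sum a {..<n}) * (u 0 + sum b {..<n}) \<le> B"
      unfolding B_def using assms
      by (intro mult_mono add_left_mono sum_le_suminf) (auto simp: sum_nonneg intro!: sum_le_suminf)
  qed
  then show "\<exists>B. \<forall>k. u k \<le> B" by blast
  show "summable w"
  proof (rule summableI_nonneg_bounded[OF w])
    fix n
    have B: "0 \<le> B" using bound[of 0] u[of 0] by linarith
    have "u n + sum w {..<n} \<le> u 0 + sum a {..<n} * B + sum b {..<n}"
    proof (induction n)
      case (Suc n)
      have "a n * u n \<le> a n * B" by (intro mult_left_mono bound a)
      then show ?case using Suc step[of n] by (simp add: algebra_simps)
    qed simp
    also have "\<dots> \<le> u 0 + suminf a * B + suminf b"
      using assms B by (intro add_mono mult_right_mono sum_le_suminf order_refl) auto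
    finally show "sum w {..<n} \<le> u 0 + suminf a * B + suminf b"
      using u[of n] by linarith
  qed
qed

text \<open>Restricting \<open>F\<close> to the line through \<open>z\<close> and
  \<open>\<theta>\<close> reduces this to the tangent inequality in one real variable between
  \<open>t = 0\<close> and \<open>t = 1\<close>.\<close>

lemma convex_on_gradient_inequality:
  fixes F :: "'a::real_inner \<Rightarrow> real"
  assumes conv: "convex_on UNIV F" and grad: "GDERIV F z :> D"
  shows "F z - F \<theta> \<le> inner (z - \<theta>) D"
proof -
  define \<phi> where "\<phi> t = F (z + t *\<^sub>R (\<theta> - z))" for t :: real
  have "convex_on UNIV \<phi>"
  proof (rule convex_onI)
    fix t x y :: real assume t: "0 < t" "t < 1"
    have "z + ((1 - t) *\<^sub>R x + t *\<^sub>R y) *\<^sub>R (\<theta> - z)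
        = (1 - t) *\<^sub>R (z + x *\<^sub>R (\<theta> - z)) + t *\<^sub>R (z + y *\<^sub>R (\<theta> - z))"
      by (simp add: algebra_simps)
    then show "\<phi> ((1 - t) *\<^sub>R x + t *\<^sub>R y) \<le> (1 - t) * \<phi> x + t * \<phi> y"
      unfolding \<phi>_def using convex_onD[OF conv] t by simp
  qed simp
  moreover have "(\<phi> has_field_derivative inner (\<theta> - z) D) (at 0)"
  proof -
    have "((\<lambda>t::real. z + t *\<^sub>R (\<theta> - z)) has_derivative (\<lambda>t. t *\<^sub>R (\<theta> - z))) (at 0)"
      by (auto intro!: derivative_eq_intros)
    from has_derivative_compose[OF this, of F "\<lambda>h. inner h D"]
    have "(\<phi> has_derivative (\<lambda>t. inner (t *\<^sub>R (\<theta> - z)) D)) (at 0)"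
      using grad by (simp add: \<phi>_def[abs_def] gderiv_def)
    then show ?thesis
      by (simp add: has_field_derivative_def mult_commute_abs)
  qed
  ultimately have "\<phi> 1 - \<phi> 0 \<ge> inner (\<theta> - z) D * (1 - 0)"
    by (intro convex_on_imp_above_tangent[of UNIV]) auto
  then show ?thesis
    by (simp add: \<phi>_def inner_diff_left)
qed

section \<open>Averages and dispersion of finite families of vectors\<close>

definition mean :: "('m::finite \<Rightarrow> 'a::real_vector) \<Rightarrow> 'a" where
  "mean u = (\<Sum>i\<in>UNIV. u i) /\<^sub>R real CARD('m)"

definition dispersion :: "('m::finite \<Rightarrow> 'a::real_inner) \<Rightarrow> real" where
  "dispersion u = (\<Sum>i\<in>UNIV. (norm (u i - mean u))\<^sup>2)"

lemma dispersion_nonneg: "0 \<le> dispersion u"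
  by (simp add: dispersion_def sum_nonneg)

lemma mean_add: "mean (\<lambda>i. u i + v i) = mean u + mean v"
  by (simp add: mean_def sum.distrib scaleR_add_right)

lemma mean_diff: "mean (\<lambda>i. u i - v i) = mean u - mean v"
  by (simp add: mean_def sum_subtractf scaleR_diff_right)

lemma mean_scaleR: "mean (\<lambda>i. t *\<^sub>R u i) = t *\<^sub>R mean u"
  by (simp add: mean_def scaleR_sum_right[symmetric])

lemma sum_eq_mean: "(\<Sum>i\<in>UNIV. u i) = real CARD('m) *\<^sub>R mean (u :: 'm::finite \<Rightarrow> _)"
  by (simp add: mean_def)

lemma sum_deviation: "(\<Sum>i\<in>UNIV. u i - mean u) = 0"
  by (simp add: sum_subtractf sum_eq_mean sum_constant_scaleR)

lemma dispersion_eq: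
  fixes u :: "'m::finite \<Rightarrow> 'a::real_inner"
  shows "dispersion u = (\<Sum>i\<in>UNIV. (norm (u i))\<^sup>2) - real CARD('m) * (norm (mean u))\<^sup>2"
proof -
  have "dispersion u = (\<Sum>i\<in>UNIV. (norm (u i))\<^sup>2) - 2 * inner (\<Sum>i\<in>UNIV. u i) (mean u)
      + real CARD('m) * (norm (mean u))\<^sup>2"
    by (simp add: dispersion_def power2_norm_eq_inner inner_diff_left inner_diff_right inner_commute
        sum.distrib sum_subtractf inner_sum_left inner_sum_right sum_distrib_left algebra_simps)
  then show ?thesis
    by (simp add: sum_eq_mean power2_norm_eq_inner)
qed

lemma dispersion_le: "dispersion u \<le> (\<Sum>i\<in>UNIV. (norm (u i))\<^sup>2)"
  by (simp add: dispersion_eq)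

lemma norm_mean_le: 
  fixes u :: "'m::finite \<Rightarrow> 'a::real_inner"
  shows "(norm (mean u))\<^sup>2 \<le> (\<Sum>i\<in>UNIV. (norm (u i))\<^sup>2)"
proof -
  have "1 * (norm (mean u))\<^sup>2 \<le> real CARD('m) * (norm (mean u))\<^sup>2"
    by (intro mult_right_mono) (auto simp: Suc_le_eq)
  then show ?thesis
    using dispersion_nonneg[of u] by (simp add: dispersion_eq)
qed

text \<open>Deviations sum to zero, so \<open>mean v\<close> drops out of the cross term. What
  remains is linear in each \<open>v i\<close> with a coefficient that depends on \<open>u\<close>
  alone, the form in which centered noise has no effect in expectation.\<close>

lemma dispersion_add_scaleR:
  "dispersion (\<lambda>i. u i + t *\<^sub>R v i)
    = dispersion u + 2 * t * (\<Sum>i\<in>UNIV. inner (u i - mean u) (v i)) + t\<^sup>2 * dispersion v"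
proof -
  have "(norm (u i + t *\<^sub>R v i - mean (\<lambda>i. u i + t *\<^sub>R v i)))\<^sup>2
      = (norm (u i - mean u))\<^sup>2 + 2 * t * inner (u i - mean u) (v i)
        - 2 * t * inner (u i - mean u) (mean v) + t\<^sup>2 * (norm (v i - mean v))\<^sup>2" for i
    unfolding mean_add mean_scaleR
    by (simp only: power2_norm_eq_inner) (simp add: inner_add_left inner_add_right inner_diff_left inner_diff_right
        inner_commute power2_eq_square algebra_simps)
  then have "dispersion (\<lambda>i. u i + t *\<^sub>R v i) = dispersion u + 2 * t * (\<Sum>i\<in>UNIV. inner (u i - mean u) (v i))
      - 2 * t * inner (\<Sum>i\<in>UNIV. u i - mean u) (mean v) + t\<^sup>2 * dispersion v"
    unfolding dispersion_def
    by (simp only: sum.distrib sum_subtractf sum_distrib_left[symmetric] inner_sum_left[symmetric])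
  then show ?thesis
    by (simp add: sum_deviation)
qed

text \<open>The weight \<open>\<tau>\<close> stays free so that each use can fit the first term into
  what the consensus contraction absorbs.\<close>

lemma young_inequality:
  fixes \<tau> t p q :: real
  assumes "0 < \<tau>"
  shows "2 * t * p * q \<le> \<tau> * p\<^sup>2 + t\<^sup>2 / \<tau> * q\<^sup>2"
proof -
  have "0 \<le> (\<tau> * p - t * q)\<^sup>2 / \<tau>"
    using assms by simp
  also have "\<dots> = \<tau> * p\<^sup>2 + t\<^sup>2 / \<tau> * q\<^sup>2 - 2 * t * p * q"
    using assms by (simp add: power2_eq_square field_simps)
  finally show ?thesis by simp
qed

lemma norm_diff_scaleR_le:
  fixes u v :: "'a::real_inner"
  assumes "0 < \<tau>"
  shows "(norm (u - t *\<^sub>R v))\<^sup>2 \<le> (1 + \<tau>) * (norm u)\<^sup>2 + (1 + 1 / \<tau>) * t\<^sup>2 * (norm v)\<^sup>2"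
proof -
  have "norm (u - t *\<^sub>R v) \<le> norm u + \<bar>t\<bar> * norm v"
    using norm_triangle_ineq4[of u "t *\<^sub>R v"] by simp
  then have "(norm (u - t *\<^sub>R v))\<^sup>2 \<le> (norm u + \<bar>t\<bar> * norm v)\<^sup>2"
    by (intro power_mono) auto
  also have "\<dots> = (norm u)\<^sup>2 + 2 * \<bar>t\<bar> * norm u * norm v + t\<^sup>2 * (norm v)\<^sup>2"
    by (simp add: power2_eq_square algebra_simps)
  also have "\<dots> \<le> (1 + \<tau>) * (norm u)\<^sup>2 + (1 + 1 / \<tau>) * t\<^sup>2 * (norm v)\<^sup>2"
    using young_inequality[OF assms, of "\<bar>t\<bar>" "norm u" "norm v"]
    by (simp add: algebra_simps)
  finally show ?thesis .
qed

lemma dispersion_diff_scaleR_le: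
  fixes u v :: "'m::finite \<Rightarrow> 'a::real_inner"
  assumes "0 < \<tau>"
  shows "dispersion (\<lambda>i. u i - t *\<^sub>R v i) \<le> (1 + \<tau>) * dispersion u + (1 + 1 / \<tau>) * t\<^sup>2 * dispersion v"
proof -
  have "dispersion (\<lambda>i. u i - t *\<^sub>R v i) = (\<Sum>i\<in>UNIV. (norm ((u i - mean u) - t *\<^sub>R (v i - mean v)))\<^sup>2)"
    unfolding dispersion_def mean_diff mean_scaleR
    by (simp add: algebra_simps)
  also have "\<dots> \<le> (\<Sum>i\<in>UNIV. (1 + \<tau>) * (norm (u i - mean u))\<^sup>2 + (1 + 1 / \<tau>) * t\<^sup>2 * (norm (v i - mean v))\<^sup>2)"
    by (intro sum_mono norm_diff_scaleR_le assms)
  finally show ?thesis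
    by (simp add: dispersion_def sum.distrib sum_distrib_left)
qed

text \<open>\<open>A\<close> acts on each coordinate of the vectors \<open>u j\<close> separately,
  so the operator norm bound on \<open>real ^ 'm\<close> is applied once for every basis vector and
  the squares are added.\<close>

lemma sum_norm_matrix_action_le:
  fixes A :: "real ^ 'm ^ 'm" and u :: "'m::finite \<Rightarrow> 'a::euclidean_space"
  shows "(\<Sum>i\<in>UNIV. (norm (\<Sum>j\<in>UNIV. A $ i $ j *\<^sub>R u j))\<^sup>2) \<le> (onorm ((*v) A))\<^sup>2 * (\<Sum>j\<in>UNIV. (norm (u j))\<^sup>2)"
proof -
  have sq: "(norm (v :: real ^ 'm))\<^sup>2 = (\<Sum>i\<in>UNIV. (v $ i)\<^sup>2)" for v
    by (simp add: norm_vec_def L2_set_def sum_nonneg)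
  have ns: "(norm (w :: 'a))\<^sup>2 = (\<Sum>b\<in>Basis. (inner w b)\<^sup>2)" for w
    by (subst euclidean_inner[of w w, folded power2_norm_eq_inner]) (simp add: power2_eq_square)
  have "(\<Sum>i\<in>UNIV. (norm (\<Sum>j\<in>UNIV. A $ i $ j *\<^sub>R u j))\<^sup>2)
      = (\<Sum>b\<in>Basis. \<Sum>i\<in>UNIV. (\<Sum>j\<in>UNIV. A $ i $ j * inner (u j) b)\<^sup>2)"
    by (subst sum.swap) (simp add: ns inner_sum_left)
  also have "\<dots> = (\<Sum>b\<in>Basis. (norm (A *v (\<chi> j. inner (u j) b)))\<^sup>2)"
    by (simp add: sq matrix_vector_mult_def)
  also have "\<dots> \<le> (\<Sum>b\<in>Basis. (onorm ((*v) A) * norm (\<chi> j. inner (u j) b))\<^sup>2)"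
    by (intro sum_mono power_mono onorm matrix_vector_mul_bounded_linear norm_ge_zero)
  also have "\<dots> = (onorm ((*v) A))\<^sup>2 * (\<Sum>b\<in>Basis. \<Sum>j\<in>UNIV. (inner (u j) b)\<^sup>2)"
    by (simp add: power_mult_distrib sum_distrib_left sq)
  also have "(\<Sum>b\<in>Basis. \<Sum>j\<in>UNIV. (inner (u j) b)\<^sup>2) = (\<Sum>j\<in>UNIV. (norm (u j))\<^sup>2)"
    by (subst sum.swap) (simp add: ns)
  finally show ?thesis .
qed

section \<open>Contraction by one consensus step\<close>

definition consensus_step :: "real ^ 'm ^ 'm \<Rightarrow> real \<Rightarrow> ('m::finite \<Rightarrow> 'a::real_vector) \<Rightarrow> 'm \<Rightarrow> 'a" where
  "consensus_step W t u i = u i + (\<Sum>j\<in>in_nbrs W i. (t * W $ i $ j) *\<^sub>R (u j - u i))"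

text \<open>The diagonal entry of \<open>W\<close> collects the terms \<open>- u i\<close>, which
  turns the sum over neighbours into the action of \<open>I + t W\<close>.\<close>

lemma consensus_step_eq:
  assumes "coupling_matrix W"
  shows "consensus_step W t u i = u i + t *\<^sub>R (\<Sum>j\<in>UNIV. W $ i $ j *\<^sub>R u j)"
proof -
  have diag: "W $ i $ i = - (\<Sum>j\<in>in_nbrs W i. W $ i $ j)"
    and off: "j \<noteq> i \<Longrightarrow> j \<notin> in_nbrs W i \<Longrightarrow> W $ i $ j = 0" for j
    using assms by (auto simp: coupling_matrix_def in_nbrs_def less_le)
  have "(\<Sum>j\<in>UNIV. W $ i $ j *\<^sub>R u j) = (\<Sum>j\<in>insert i (in_nbrs W i). W $ i $ j *\<^sub>R u j)"
    using off by (intro sum.mono_neutral_right) auto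
  also have "\<dots> = W $ i $ i *\<^sub>R u i + (\<Sum>j\<in>in_nbrs W i. W $ i $ j *\<^sub>R u j)"
    by (subst sum.insert) (auto simp: in_nbrs_def)
  also have "\<dots> = (\<Sum>j\<in>in_nbrs W i. W $ i $ j *\<^sub>R (u j - u i))"
    by (simp add: diag scaleR_diff_right sum_subtractf scaleR_sum_left)
  finally show ?thesis
    by (simp add: consensus_step_def scaleR_sum_right)
qed

lemma mean_consensus_step:
  assumes W: "coupling_matrix W" and cols: "1 v* W = 0"
  shows "mean (consensus_step W t u) = mean u"
proof -
  have col: "(\<Sum>i\<in>UNIV. W $ i $ j) = 0" for j
    using arg_cong[OF cols, of "\<lambda>v. v $ j"] by (simp add: vector_matrix_mult_def)
  have "(\<Sum>i\<in>UNIV. \<Sum>j\<in>UNIV. W $ i $ j *\<^sub>R u j) = 0"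
    by (subst sum.swap) (simp add: scaleR_sum_left[symmetric] col)
  then show ?thesis
    by (simp add: mean_def consensus_step_eq[OF W] sum.distrib scaleR_sum_right[symmetric])
qed

text \<open>On families with zero sum the averaging matrix vanishes, so there \<open>I + t W\<close>
  equals the convex combination \<open>(1 - t) I + t B\<close> with
  \<open>B = I + W - avg_matrix\<close>. Its norm is at most
  \<open>(1 - t) + t \<eta> = 1 - (1 - \<eta>) t\<close>. This is where \<open>t \<le> 1\<close>
  enters.\<close>

lemma dispersion_consensus_step_le:
  fixes u :: "'m::finite \<Rightarrow> 'a::euclidean_space"
  assumes W: "coupling_matrix W" and cols: "1 v* W = 0" and rows: "W *v 1 = 0"
    and t: "0 \<le> t" "t \<le> 1"
  defines "\<eta> \<equiv> onorm ((*v) (mat 1 + W - avg_matrix))"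
  assumes \<eta>: "\<eta> < 1"
  shows "dispersion (consensus_step W t u) \<le> (1 - (1 - \<eta>) * t)\<^sup>2 * dispersion u"
proof -
  define e where "e i = u i - mean u" for i
  define B where "B = mat 1 + W - avg_matrix"
  have row: "(\<Sum>j\<in>UNIV. W $ i $ j) = 0" for i
    using arg_cong[OF rows, of "\<lambda>v. v $ i"] by (simp add: matrix_vector_mult_def)
  have sum_e: "(\<Sum>j\<in>UNIV. e j) = 0"
    by (simp add: e_def sum_deviation)
  \<comment> \<open>The rows of \<open>W\<close> sum to zero, so \<open>W\<close> does not
    distinguish \<open>e\<close> from \<open>u\<close>, and \<open>avg_matrix\<close> annihilates
    \<open>e\<close>.\<close>
  have act: "(\<Sum>j\<in>UNIV. B $ i $ j *\<^sub>R e j) = e i + (\<Sum>j\<in>UNIV. W $ i $ j *\<^sub>R u j)" for i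
  proof -
    have "(\<Sum>j\<in>UNIV. (mat 1 :: real^'m^'m) $ i $ j *\<^sub>R e j) = e i"
      by (simp add: mat_def if_distrib[of "\<lambda>c. c *\<^sub>R _"] cong: if_cong)
    moreover have "(\<Sum>j\<in>UNIV. W $ i $ j *\<^sub>R e j) = (\<Sum>j\<in>UNIV. W $ i $ j *\<^sub>R u j)"
      by (simp add: e_def scaleR_diff_right sum_subtractf scaleR_sum_left[symmetric] row)
    moreover have "(\<Sum>j\<in>UNIV. (avg_matrix :: real^'m^'m) $ i $ j *\<^sub>R e j) = 0"
      by (simp add: avg_matrix_def scaleR_sum_right[symmetric] sum_e)
    ultimately show ?thesis
      by (simp add: B_def scaleR_add_left scaleR_diff_left sum.distrib sum_subtractf)
  qed
  have \<eta>0: "0 \<le> \<eta>"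
    unfolding \<eta>_def by (rule onorm_pos_le[OF matrix_vector_mul_bounded_linear])
  have eq: "consensus_step W t u i - mean u = (1 - t) *\<^sub>R e i + t *\<^sub>R (\<Sum>j\<in>UNIV. B $ i $ j *\<^sub>R e j)" for i
    unfolding act consensus_step_eq[OF W] by (simp add: e_def algebra_simps)
  have "L2_set (\<lambda>i. norm (consensus_step W t u i - mean u)) UNIV
      \<le> L2_set (\<lambda>i. (1 - t) * norm (e i) + t * norm (\<Sum>j\<in>UNIV. B $ i $ j *\<^sub>R e j)) UNIV"
    unfolding eq using t
    by (intro L2_set_mono) (auto intro: norm_triangle_le)
  also have "\<dots> \<le> L2_set (\<lambda>i. (1 - t) * norm (e i)) UNIV + L2_set (\<lambda>i. t * norm (\<Sum>j\<in>UNIV. B $ i $ j *\<^sub>R e j)) UNIV"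
    by (rule L2_set_triangle_ineq)
  also have "\<dots> = (1 - t) * L2_set (\<lambda>i. norm (e i)) UNIV + t * L2_set (\<lambda>i. norm (\<Sum>j\<in>UNIV. B $ i $ j *\<^sub>R e j)) UNIV"
    using t by (simp add: L2_set_right_distrib)
  also have "\<dots> \<le> (1 - t) * L2_set (\<lambda>i. norm (e i)) UNIV + t * (\<eta> * L2_set (\<lambda>i. norm (e i)) UNIV)"
  proof (intro add_left_mono mult_left_mono t)
    have "L2_set (\<lambda>i. norm (\<Sum>j\<in>UNIV. B $ i $ j *\<^sub>R e j)) UNIV \<le> sqrt (\<eta>\<^sup>2 * (\<Sum>j\<in>UNIV. (norm (e j))\<^sup>2))"
      unfolding L2_set_def using sum_norm_matrix_action_le[of B e]
      by (simp add: \<eta>_def B_def)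
    also have "\<dots> = \<eta> * L2_set (\<lambda>i. norm (e i)) UNIV"
      using \<eta>0 by (simp add: L2_set_def real_sqrt_mult)
    finally show "L2_set (\<lambda>i. norm (\<Sum>j\<in>UNIV. B $ i $ j *\<^sub>R e j)) UNIV \<le> \<eta> * L2_set (\<lambda>i. norm (e i)) UNIV" .
  qed
  also have "\<dots> = (1 - (1 - \<eta>) * t) * L2_set (\<lambda>i. norm (e i)) UNIV"
    by (simp add: algebra_simps)
  finally have "(L2_set (\<lambda>i. norm (consensus_step W t u i - mean u)) UNIV)\<^sup>2
      \<le> ((1 - (1 - \<eta>) * t) * L2_set (\<lambda>i. norm (e i)) UNIV)\<^sup>2"
    by (intro power_mono) auto
  then show ?thesis
    by (simp add: dispersion_def mean_consensus_step[OF W cols] L2_set_def e_def power_mult_distrib sum_nonneg)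
qed

section \<open>From weighted sums to limits\<close>

text \<open>If \<open>y\<close> eventually stayed at least \<open>\<epsilon>\<close>, then
  \<open>a k\<close> would eventually be dominated by \<open>a k * y k / \<epsilon>\<close>, and
  \<open>a\<close> would be summable.\<close>

lemma frequently_small_if_weighted_summable:
  fixes a y :: "nat \<Rightarrow> real"
  assumes a: "\<And>k. 0 \<le> a k" and sum: "summable (\<lambda>k. a k * y k)" and div: "\<not> summable a" and "0 < \<epsilon>"
  shows "\<exists>\<^sub>F k in sequentially. y k < \<epsilon>"
proof (rule ccontr)
  assume "\<not> ?thesis"
  then have "\<forall>\<^sub>F k in sequentially. \<epsilon> \<le> y k"
    by (simp add: frequently_def not_less)
  then have "\<forall>\<^sub>F k in sequentially. norm (a k) \<le> inverse \<epsilon> * (a k * y k)"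
  proof eventually_elim
    case (elim k)
    have "a k * 1 \<le> a k * (inverse \<epsilon> * y k)"
      using a elim \<open>0 < \<epsilon>\<close> by (intro mult_left_mono) (auto simp: field_simps)
    then show ?case using a by (simp add: ac_simps)
  qed
  then have "summable a"
    using summable_comparison_test_ev[OF _ summable_mult[OF sum]] by blast
  with div show False ..
qed

lemma tendsto_zero_if_weighted_summable:
  fixes a y :: "nat \<Rightarrow> real"
  assumes "\<And>k. 0 \<le> a k" "summable (\<lambda>k. a k * y k)" "\<not> summable a"
    and y: "\<And>k. 0 \<le> y k" "convergent y"
  shows "y \<longlonglongrightarrow> 0"
proof -
  obtain l where l: "y \<longlonglongrightarrow> l" using y(2) by (auto simp: convergent_def)
  have "0 \<le> l" using l y(1) by (intro LIMSEQ_le_const) auto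
  moreover have False if "0 < l"
  proof -
    have "\<forall>\<^sub>F k in sequentially. \<not> y k < l / 2"
      using order_tendstoD(1)[OF l, of "l / 2"] that by (auto elim: eventually_mono)
    moreover have "\<exists>\<^sub>F k in sequentially. y k < l / 2"
      using frequently_small_if_weighted_summable[OF assms(1-3), of "l / 2"] that by simp
    ultimately show False by (simp add: frequently_def)
  qed
  ultimately show ?thesis using l by (cases "l = 0") auto
qed

text \<open>Opial's argument, with a countable dense set of minimisers in place of all of them, because
  only countably many exceptional null sets may be united.\<close>

lemma convergent_to_minimiser:
  fixes F :: "'a::euclidean_space \<Rightarrow> real" and z :: "nat \<Rightarrow> 'a"
  assumes cont: "continuous_on UNIV F"
    and min: "optimal_solution F \<theta>\<^sub>0"
    and dense: "{\<theta>. optimal_solution F \<theta>} \<subseteq> closure T"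
    and conv: "\<And>q. q \<in> T \<Longrightarrow> convergent (\<lambda>k. dist (z k) q)"
    and freq: "\<And>\<epsilon>. 0 < \<epsilon> \<Longrightarrow> \<exists>\<^sub>F k in sequentially. F (z k) < F \<theta>\<^sub>0 + \<epsilon>"
  shows "\<exists>\<theta>. optimal_solution F \<theta> \<and> z \<longlonglongrightarrow> \<theta>"
proof -
  have "T \<noteq> {}" using min dense by auto
  then obtain q\<^sub>0 where q\<^sub>0: "q\<^sub>0 \<in> T" by blast
  obtain B where B: "\<And>k. dist (z k) q\<^sub>0 \<le> B"
    using convergent_imp_Bseq[OF conv[OF q\<^sub>0]] by (auto simp: Bseq_def)
  \<comment> \<open>The chosen indices \<open>s n\<close> need not increase. The bound
    \<open>n \<le> s n\<close> is enough for \<open>s (r n)\<close> to tend to infinity.\<close>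
  have "\<exists>k\<ge>n. F (z k) < F \<theta>\<^sub>0 + inverse (real (Suc n))" for n
    using freq[of "inverse (real (Suc n))"] by (simp add: frequently_sequentially)
  then obtain s where s: "\<And>n. n \<le> s n" "\<And>n. F (z (s n)) < F \<theta>\<^sub>0 + inverse (real (Suc n))"
    by metis
  have "\<forall>n. z (s n) \<in> cball q\<^sub>0 B" using B by (simp add: dist_commute)
  then obtain \<theta> r where r: "strict_mono r" and lim: "((\<lambda>n. z (s n)) \<circ> r) \<longlonglongrightarrow> \<theta>"
    using compact_cball[of q\<^sub>0 B] unfolding compact_def by metis
  have lim: "(\<lambda>n. z (s (r n))) \<longlonglongrightarrow> \<theta>" using lim by (simp add: o_def)
  have sub: "filterlim (\<lambda>n. s (r n)) at_top sequentially"
    using filterlim_compose[OF filterlim_at_top_mono[OF filterlim_ident always_eventually] filterlim_subseq[OF r], of s] s(1)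
    by blast
  have "F \<theta> \<le> F \<theta>\<^sub>0"
  proof (rule LIMSEQ_le)
    show "(\<lambda>n. F (z (s (r n)))) \<longlonglongrightarrow> F \<theta>"
      using cont lim by (intro continuous_on_tendsto_compose[OF cont]) auto
    have "(\<lambda>n. F \<theta>\<^sub>0 + inverse (real (Suc n))) \<longlonglongrightarrow> F \<theta>\<^sub>0 + 0"
      by (intro tendsto_intros LIMSEQ_inverse_real_of_nat)
    from LIMSEQ_subseq_LIMSEQ[OF this r] show "(\<lambda>n. F \<theta>\<^sub>0 + inverse (real (Suc (r n)))) \<longlonglongrightarrow> F \<theta>\<^sub>0"
      by (simp add: o_def)
    show "\<exists>N. \<forall>n\<ge>N. F (z (s (r n))) \<le> F \<theta>\<^sub>0 + inverse (real (Suc (r n)))"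
      using s(2) less_imp_le by blast
  qed
  then have opt: "optimal_solution F \<theta>"
    using min by (auto simp: optimal_solution_def is_arg_min_linorder intro: order_trans)
  have "z \<longlonglongrightarrow> \<theta>"
  proof (rule metric_LIMSEQ_I)
    fix \<epsilon> :: real assume "0 < \<epsilon>"
    then obtain q where q: "q \<in> T" "dist q \<theta> < \<epsilon> / 2"
      using opt dense closure_approachable[of \<theta> T] by (metis half_gt_zero mem_Collect_eq subsetD)
    obtain l where l: "(\<lambda>k. dist (z k) q) \<longlonglongrightarrow> l"
      using conv[OF q(1)] by (auto simp: convergent_def)
    have "(\<lambda>n. dist (z (s (r n))) q) \<longlonglongrightarrow> l"
      using filterlim_compose[OF l sub] .
    moreover have "(\<lambda>n. dist (z (s (r n))) q) \<longlonglongrightarrow> dist \<theta> q"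
      using lim by (intro tendsto_intros)
    \<comment> \<open>The whole sequence of distances to \<open>q\<close> converges, so its limit
      can be read off along the subsequence. It is below \<open>\<epsilon> / 2\<close>, which brings
      all late \<open>z k\<close> close to \<open>q\<close> and hence to
      \<open>\<theta>\<close>.\<close>
    ultimately have "l = dist \<theta> q" by (rule LIMSEQ_unique)
    then have "l < \<epsilon> / 2" using q(2) by (simp add: dist_commute)
    then have "\<forall>\<^sub>F k in sequentially. dist (z k) q < \<epsilon> / 2"
      by (rule order_tendstoD(2)[OF l])
    then have "\<forall>\<^sub>F k in sequentially. dist (z k) \<theta> < \<epsilon>"
    proof eventually_elim
      case (elim k)
      then show ?case using dist_triangle[of "z k" \<theta> q] q(2) by linarith
    qed
    then show "\<exists>N. \<forall>n\<ge>N. dist (z n) \<theta> < \<epsilon>" by (simp add: eventually_sequentially)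
  qed
  with opt show ?thesis by blast
qed

lemma norm_add3_square_le:
  fixes p q r :: real
  shows "(p + q + r)\<^sup>2 \<le> 3 * p\<^sup>2 + 3 * q\<^sup>2 + 3 * r\<^sup>2"
proof -
  have "3 * p\<^sup>2 + 3 * q\<^sup>2 + 3 * r\<^sup>2 - (p + q + r)\<^sup>2 = (p - q)\<^sup>2 + (q - r)\<^sup>2 + (p - r)\<^sup>2"
    by (simp add: power2_eq_square algebra_simps)
  also have "\<dots> \<ge> 0" by simp
  finally show ?thesis by simp
qed

section \<open>One iteration without noise\<close>

locale consensus_problem =
  fixes f :: "'m::finite \<Rightarrow> real ^ 'd \<Rightarrow> real"
    and g :: "'m \<Rightarrow> real ^ 'd \<Rightarrow> real ^ 'd"
    and W :: "real ^ 'm ^ 'm"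
    and L :: real
  assumes grad: "\<And>i u. GDERIV (f i) u :> g i u"
    and coupling: "coupling_matrix W"
    and convex: "convex_on UNIV (objective f)"
    and L_pos: "L > 0"
    and grad_lipschitz: "\<And>i u v. norm (g i u - g i v) \<le> L * norm (u - v)"
    and W_cols: "1 v* W = 0"
    and W_rows: "W *v 1 = 0"
    and W_norm: "onorm ((*v) (mat 1 + W - avg_matrix)) < 1"
begin

definition spectral_gap :: real where
  "spectral_gap = 1 - onorm ((*v) (mat 1 + W - avg_matrix))"

lemma spectral_gap: "0 < spectral_gap" "spectral_gap \<le> 1"
  using W_norm onorm_pos_le[OF matrix_vector_mul_bounded_linear, of "mat 1 + W - avg_matrix"]
  by (auto simp: spectral_gap_def)

lemma gradient_objective: "GDERIV (objective f) z :> mean (\<lambda>i. g i z)"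
proof -
  have "((\<lambda>z. \<Sum>i\<in>UNIV. f i z) has_derivative (\<lambda>h. \<Sum>i\<in>UNIV. inner h (g i z))) (at z)"
    using grad by (intro has_derivative_sum) (simp add: gderiv_def)
  then have "((\<lambda>z. (\<Sum>i\<in>UNIV. f i z) / real CARD('m)) has_derivative
      (\<lambda>h. (\<Sum>i\<in>UNIV. inner h (g i z)) / real CARD('m))) (at z)"
    by (rule bounded_linear.has_derivative[OF bounded_linear_divide])
  then show ?thesis
    by (simp add: gderiv_def objective_def[abs_def] mean_def inner_sum_right divide_inverse mult.commute)
qed

lemma continuous_objective: "continuous_on UNIV (objective f)"
  using gradient_objective unfolding gderiv_def
  by (intro continuous_at_imp_continuous_on ballI has_derivative_continuous) blast

text \<open>The summand 1 absorbs the gradients at \<open>\<theta>\<close>: at a minimiser their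
  mean vanishes, but the individual ones need not.\<close>

definition lyapunov :: "real ^ 'd \<Rightarrow> ('m \<Rightarrow> real ^ 'd) \<Rightarrow> real" where
  "lyapunov \<theta> u = 1 + dispersion u + (norm (mean u - \<theta>))\<^sup>2"

definition gradient_const :: "real ^ 'd \<Rightarrow> real" where
  "gradient_const \<theta> = 3 * L\<^sup>2 + 3 * real CARD('m) * L\<^sup>2 + 3 * (\<Sum>i\<in>UNIV. (norm (g i \<theta>))\<^sup>2)"

lemma gradient_const_nonneg: "0 \<le> gradient_const \<theta>"
  by (simp add: gradient_const_def sum_nonneg)

text \<open>Going from \<open>u i\<close> through \<open>mean u\<close> to \<open>\<theta>\<close>
  splits each gradient into two Lipschitz differences and the gradient at \<open>\<theta>\<close>.
  Squaring a sum of three terms costs the factor 3 seen in \<open>gradient_const\<close>.\<close>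

lemma sum_norm_gradient_le:
  "(\<Sum>i\<in>UNIV. (norm (g i (u i)))\<^sup>2) \<le> gradient_const \<theta> * lyapunov \<theta> u"
proof -
  have "(norm (g i (u i)))\<^sup>2 \<le> 3 * L\<^sup>2 * (norm (u i - mean u))\<^sup>2 + 3 * L\<^sup>2 * (norm (mean u - \<theta>))\<^sup>2 + 3 * (norm (g i \<theta>))\<^sup>2" for i
  proof -
    have "norm (g i (u i)) \<le> norm (g i (u i) - g i (mean u)) + norm (g i (mean u) - g i \<theta>) + norm (g i \<theta>)"
      by norm
    also have "\<dots> \<le> L * norm (u i - mean u) + L * norm (mean u - \<theta>) + norm (g i \<theta>)"
      by (intro add_mono grad_lipschitz order_refl)
    finally have "(norm (g i (u i)))\<^sup>2 \<le> (L * norm (u i - mean u) + L * norm (mean u - \<theta>) + norm (g i \<theta>))\<^sup>2"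
      by (intro power_mono) auto
    also note norm_add3_square_le
    finally show ?thesis by (simp add: power_mult_distrib)
  qed
  then have "(\<Sum>i\<in>UNIV. (norm (g i (u i)))\<^sup>2) \<le> (\<Sum>i\<in>UNIV. 3 * L\<^sup>2 * (norm (u i - mean u))\<^sup>2
      + 3 * L\<^sup>2 * (norm (mean u - \<theta>))\<^sup>2 + 3 * (norm (g i \<theta>))\<^sup>2)"
    by (rule sum_mono)
  also have "\<dots> = 3 * L\<^sup>2 * dispersion u + 3 * real CARD('m) * L\<^sup>2 * (norm (mean u - \<theta>))\<^sup>2
      + 3 * (\<Sum>i\<in>UNIV. (norm (g i \<theta>))\<^sup>2) * 1"
    by (simp add: dispersion_def sum.distrib sum_distrib_left)
  also have "\<dots> \<le> 3 * L\<^sup>2 * lyapunov \<theta> u + 3 * real CARD('m) * L\<^sup>2 * lyapunov \<theta> u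
      + 3 * (\<Sum>i\<in>UNIV. (norm (g i \<theta>))\<^sup>2) * lyapunov \<theta> u"
    using dispersion_nonneg[of u]
    by (intro add_mono mult_left_mono) (auto simp: lyapunov_def sum_nonneg)
  finally show ?thesis
    by (simp add: gradient_const_def algebra_simps)
qed

text \<open>The word mean refers here to the conditional mean of the next states given the past, not
  to the average over the agents.\<close>

definition mean_step :: "real \<Rightarrow> real \<Rightarrow> ('m \<Rightarrow> real ^ 'd) \<Rightarrow> 'm \<Rightarrow> real ^ 'd" where
  "mean_step t s u i = consensus_step W t u i - s *\<^sub>R g i (u i)"

text \<open>The two summands come from different sources: \<open>gradient_const\<close> from the
  squared gradient steps, and \<open>L\<^sup>2\<close> from Young's inequality for the cross term in
  the distance estimate.\<close>

definition step_const :: "real ^ 'd \<Rightarrow> real" where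
  "step_const \<theta> = 2 * (gradient_const \<theta> + L\<^sup>2) / spectral_gap"

lemma step_const_nonneg: "0 \<le> step_const \<theta>"
  using spectral_gap gradient_const_nonneg[of \<theta>] by (simp add: step_const_def)

lemma lyapunov_ge: "1 \<le> lyapunov \<theta> u" "dispersion u \<le> lyapunov \<theta> u" "(norm (mean u - \<theta>))\<^sup>2 \<le> lyapunov \<theta> u"
  using dispersion_nonneg[of u] by (auto simp: lyapunov_def)

text \<open>Young's weight is set to the contraction rate \<open>\<tau> = spectral_gap * t\<close>.
  Of the two contraction factors \<open>1 - \<tau>\<close>, one pays for the growth
  \<open>1 + \<tau>\<close> and the other remains. The gradient part is multiplied by about
  \<open>1 / \<tau>\<close>, which produces the ratio \<open>s\<^sup>2 / t\<close>.\<close>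

lemma dispersion_mean_step_le:
  assumes t: "0 < t" "t \<le> 1"
  shows "dispersion (mean_step t s u)
    \<le> dispersion u - spectral_gap * t * dispersion u + step_const \<theta> * (s\<^sup>2 / t) * lyapunov \<theta> u"
proof -
  define \<tau> where "\<tau> = spectral_gap * t"
  have \<tau>: "0 < \<tau>" "\<tau> \<le> 1"
    using spectral_gap t by (auto simp: \<tau>_def mult_le_one)
  have "dispersion (mean_step t s u) \<le> (1 + \<tau>) * dispersion (consensus_step W t u)
      + (1 + 1 / \<tau>) * s\<^sup>2 * dispersion (\<lambda>i. g i (u i))"
    unfolding mean_step_def[abs_def] by (rule dispersion_diff_scaleR_le[OF \<tau>(1)])
  also have "\<dots> \<le> (1 + \<tau>) * ((1 - \<tau>)\<^sup>2 * dispersion u)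
      + (2 / \<tau>) * s\<^sup>2 * (gradient_const \<theta> * lyapunov \<theta> u)"
  proof (intro add_mono mult_mono)
    show "dispersion (consensus_step W t u) \<le> (1 - \<tau>)\<^sup>2 * dispersion u"
      using dispersion_consensus_step_le[OF coupling W_cols W_rows _ _ W_norm, of t u] t
      by (simp add: \<tau>_def spectral_gap_def)
    show "dispersion (\<lambda>i. g i (u i)) \<le> gradient_const \<theta> * lyapunov \<theta> u"
      using dispersion_le sum_norm_gradient_le by (rule order_trans)
    show "1 + 1 / \<tau> \<le> 2 / \<tau>" using \<tau> by (simp add: field_simps)
  qed (use \<tau> dispersion_nonneg in auto)
  also have "(1 + \<tau>) * ((1 - \<tau>)\<^sup>2 * dispersion u) \<le> (1 - \<tau>) * dispersion u"
  proof -
    have "(1 + \<tau>) * (1 - \<tau>)\<^sup>2 = (1 - \<tau>) * (1 - \<tau>\<^sup>2)"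
      by (simp add: power2_eq_square algebra_simps)
    also have "\<dots> \<le> (1 - \<tau>) * 1"
      using \<tau> by (intro mult_left_mono) auto
    finally show ?thesis
      using mult_right_mono[OF _ dispersion_nonneg[of u]] by (metis mult.assoc mult.right_neutral)
  qed
  also have "(2 / \<tau>) * s\<^sup>2 * (gradient_const \<theta> * lyapunov \<theta> u) \<le> step_const \<theta> * (s\<^sup>2 / t) * lyapunov \<theta> u"
  proof -
    have "2 * gradient_const \<theta> / spectral_gap \<le> step_const \<theta>"
      unfolding step_const_def using spectral_gap by (intro divide_right_mono) auto
    then have "2 * gradient_const \<theta> / spectral_gap * ((s\<^sup>2 / t) * lyapunov \<theta> u) \<le> step_const \<theta> * ((s\<^sup>2 / t) * lyapunov \<theta> u)"
      using t lyapunov_ge[where u = u and \<theta> = \<theta>] by (intro mult_right_mono) auto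
    then show ?thesis by (simp add: \<tau>_def ac_simps)
  qed
  finally show ?thesis
    by (simp add: \<tau>_def algebra_simps)
qed

text \<open>The consensus part leaves the average untouched, so the average makes a gradient step
  along \<open>G\<close>. Adding the mismatch \<open>R\<close> turns \<open>G\<close> into the
  gradient of the objective at \<open>mean u\<close>, where convexity applies. The mismatch is
  controlled by the dispersion.\<close>

lemma norm_mean_mean_step_le:
  assumes t: "0 < t" "t \<le> 1" and s: "0 \<le> s"
  shows "(norm (mean (mean_step t s u) - \<theta>))\<^sup>2
    \<le> (norm (mean u - \<theta>))\<^sup>2 - 2 * s * (objective f (mean u) - objective f \<theta>)
      + spectral_gap / 2 * t * dispersion u + step_const \<theta> * (s\<^sup>2 / t) * lyapunov \<theta> u"
proof -
  define d where "d = mean u - \<theta>"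
  define G where "G = mean (\<lambda>i. g i (u i))"
  define R where "R = mean (\<lambda>i. g i (mean u) - g i (u i))"
  have "mean (mean_step t s u) = mean u - s *\<^sub>R G"
    unfolding mean_step_def[abs_def] G_def mean_diff mean_scaleR
    using mean_consensus_step[OF coupling W_cols] by simp
  then have "mean (mean_step t s u) - \<theta> = d - s *\<^sub>R G"
    by (simp add: d_def)
  then have eq: "(norm (mean (mean_step t s u) - \<theta>))\<^sup>2 = (norm d)\<^sup>2 - 2 * s * inner d G + s\<^sup>2 * (norm G)\<^sup>2"
    by (simp only: power2_norm_eq_inner)
      (simp add: inner_diff_left inner_diff_right inner_commute power2_eq_square algebra_simps)
  have "objective f (mean u) - objective f \<theta> \<le> inner d (mean (\<lambda>i. g i (mean u)))"
    unfolding d_def by (rule convex_on_gradient_inequality[OF convex gradient_objective])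
  also have "\<dots> = inner d G + inner d R"
    by (simp add: G_def R_def mean_diff inner_diff_right)
  finally have grad_le: "s * (objective f (mean u) - objective f \<theta>) \<le> s * (inner d G + inner d R)"
    using s by (rule mult_left_mono)
  have R_le: "(norm R)\<^sup>2 \<le> L\<^sup>2 * dispersion u"
  proof -
    have "(norm R)\<^sup>2 \<le> (\<Sum>i\<in>UNIV. (norm (g i (mean u) - g i (u i)))\<^sup>2)"
      unfolding R_def by (rule norm_mean_le)
    also have "\<dots> \<le> (\<Sum>i\<in>UNIV. (L * norm (mean u - u i))\<^sup>2)"
      by (intro sum_mono power_mono grad_lipschitz) auto
    finally show ?thesis
      by (simp add: dispersion_def power_mult_distrib sum_distrib_left norm_minus_commute)
  qed
  \<comment> \<open>Chosen so that \<open>\<tau> * L\<^sup>2\<close> is half of the contraction rate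
    \<open>spectral_gap * t\<close>; the other half survives when the two estimates are
    added.\<close>
  define \<tau> where "\<tau> = spectral_gap * t / (2 * L\<^sup>2)"
  have \<tau>: "0 < \<tau>" using spectral_gap t L_pos by (simp add: \<tau>_def)
  have "2 * s * inner d R \<le> 2 * s * (norm R * norm d)"
    using s norm_cauchy_schwarz[of d R] by (intro mult_left_mono) (auto simp: mult.commute)
  also have "\<dots> \<le> \<tau> * (norm R)\<^sup>2 + s\<^sup>2 / \<tau> * (norm d)\<^sup>2"
    using young_inequality[OF \<tau>, of s "norm R" "norm d"] by (simp add: mult.assoc)
  also have "\<tau> * (norm R)\<^sup>2 \<le> \<tau> * (L\<^sup>2 * dispersion u)"
    using \<tau> R_le by (intro mult_left_mono) auto
  also have "\<tau> * (L\<^sup>2 * dispersion u) = spectral_gap / 2 * t * dispersion u"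
    using L_pos by (simp add: \<tau>_def)
  also have "s\<^sup>2 / \<tau> * (norm d)\<^sup>2 = 2 * L\<^sup>2 / spectral_gap * (s\<^sup>2 / t) * (norm d)\<^sup>2"
    by (simp add: \<tau>_def)
  also have "\<dots> \<le> 2 * L\<^sup>2 / spectral_gap * (s\<^sup>2 / t) * lyapunov \<theta> u"
    using t spectral_gap lyapunov_ge[where u = u and \<theta> = \<theta>] by (intro mult_left_mono) (auto simp: d_def)
  finally have cross: "2 * s * inner d R
    \<le> spectral_gap / 2 * t * dispersion u + 2 * L\<^sup>2 / spectral_gap * (s\<^sup>2 / t) * lyapunov \<theta> u"
    by simp
  have "s\<^sup>2 * (norm G)\<^sup>2 \<le> (s\<^sup>2 / t) * ((2 * gradient_const \<theta> / spectral_gap) * lyapunov \<theta> u)"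
  proof (intro mult_mono)
    show "s\<^sup>2 \<le> s\<^sup>2 / t" using t by (simp add: pos_le_divide_eq mult_left_le)
    have "(norm G)\<^sup>2 \<le> gradient_const \<theta> * lyapunov \<theta> u"
      unfolding G_def using norm_mean_le sum_norm_gradient_le by (rule order_trans)
    also have "gradient_const \<theta> \<le> 2 * gradient_const \<theta> / spectral_gap"
      using spectral_gap gradient_const_nonneg[of \<theta>]
      by (auto simp: pos_le_divide_eq mult.commute[of _ spectral_gap] intro!: mult_right_mono)
    finally show "(norm G)\<^sup>2 \<le> (2 * gradient_const \<theta> / spectral_gap) * lyapunov \<theta> u"
      using lyapunov_ge[where u = u and \<theta> = \<theta>] by (simp add: mult_right_mono)
  qed (use t in auto)
  moreover have "step_const \<theta> * (s\<^sup>2 / t) * lyapunov \<theta> u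
      = 2 * L\<^sup>2 / spectral_gap * (s\<^sup>2 / t) * lyapunov \<theta> u
        + (s\<^sup>2 / t) * ((2 * gradient_const \<theta> / spectral_gap) * lyapunov \<theta> u)"
    by (simp add: step_const_def add_divide_distrib algebra_simps)
  ultimately show ?thesis
    using cross grad_le unfolding eq d_def[symmetric] by (simp add: algebra_simps)
qed

end

subsection \<open>Square integrable random vectors\<close>

definition square_integrable :: "'w measure \<Rightarrow> ('w \<Rightarrow> 'a::euclidean_space) \<Rightarrow> bool" where
  "square_integrable M Z \<longleftrightarrow> Z \<in> borel_measurable M \<and> integrable M (\<lambda>\<omega>. (norm (Z \<omega>))\<^sup>2)"

lemma square_integrable_measurable: "square_integrable M Z \<Longrightarrow> Z \<in> borel_measurable M"
  by (simp add: square_integrable_def)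

lemma square_integrable_norm: "square_integrable M Z \<Longrightarrow> integrable M (\<lambda>\<omega>. (norm (Z \<omega>))\<^sup>2)"
  by (simp add: square_integrable_def)

lemma square_integrable_scaleR:
  "square_integrable M Z \<Longrightarrow> square_integrable M (\<lambda>\<omega>. t *\<^sub>R Z \<omega>)"
  by (auto simp: square_integrable_def power_mult_distrib)

lemma square_integrable_add:
  fixes X Y :: "'w \<Rightarrow> 'a::euclidean_space"
  assumes "square_integrable M X" "square_integrable M Y"
  shows "square_integrable M (\<lambda>\<omega>. X \<omega> + Y \<omega>)"
  unfolding square_integrable_def
proof
  have [measurable]: "X \<in> borel_measurable M" "Y \<in> borel_measurable M"
    using assms by (simp_all add: square_integrable_def)
  show "(\<lambda>\<omega>. X \<omega> + Y \<omega>) \<in> borel_measurable M" by measurable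
  show "integrable M (\<lambda>\<omega>. (norm (X \<omega> + Y \<omega>))\<^sup>2)"
  proof (rule Bochner_Integration.integrable_bound)
    show "integrable M (\<lambda>\<omega>. 2 * (norm (X \<omega>))\<^sup>2 + 2 * (norm (Y \<omega>))\<^sup>2)"
      using assms by (auto simp: square_integrable_def)
    have "(norm (X \<omega> + Y \<omega>))\<^sup>2 \<le> 2 * (norm (X \<omega>))\<^sup>2 + 2 * (norm (Y \<omega>))\<^sup>2" for \<omega>
    proof -
      have "2 * (norm (X \<omega>))\<^sup>2 + 2 * (norm (Y \<omega>))\<^sup>2 - (norm (X \<omega> + Y \<omega>))\<^sup>2 = (norm (X \<omega> - Y \<omega>))\<^sup>2"
        by (simp add: power2_norm_eq_inner inner_add_left inner_add_right inner_diff_left inner_diff_right inner_commute)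
      then show ?thesis by (smt (verit) zero_le_power2)
    qed
    then show "AE \<omega> in M. norm ((norm (X \<omega> + Y \<omega>))\<^sup>2) \<le> norm (2 * (norm (X \<omega>))\<^sup>2 + 2 * (norm (Y \<omega>))\<^sup>2)"
      by auto
  qed measurable
qed

lemma square_integrable_diff:
  fixes X Y :: "'w \<Rightarrow> 'a::euclidean_space"
  assumes "square_integrable M X" "square_integrable M Y"
  shows "square_integrable M (\<lambda>\<omega>. X \<omega> - Y \<omega>)"
  using square_integrable_add[OF assms(1) square_integrable_scaleR[OF assms(2), of "-1"]] by simp

lemma square_integrable_sum:
  assumes "\<And>i. i \<in> I \<Longrightarrow> square_integrable M (Z i)"
  shows "square_integrable M (\<lambda>\<omega>. \<Sum>i\<in>I. Z i \<omega>)"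
  using assms
proof (induction I rule: infinite_finite_induct)
  case (insert i I)
  then show ?case by (simp add: square_integrable_add)
qed (auto simp: square_integrable_def)

lemma (in finite_measure) square_integrable_const:
  fixes c :: "'b::euclidean_space"
  shows "square_integrable M (\<lambda>_. c)"
  by (simp add: square_integrable_def)

lemma square_integrable_indicator:
  assumes "square_integrable M Z" "A \<in> sets M"
  shows "square_integrable M (\<lambda>\<omega>. indicator A \<omega> *\<^sub>R Z \<omega>)"
proof -
  have [measurable]: "Z \<in> borel_measurable M" using assms by (simp add: square_integrable_def)
  have "integrable M (\<lambda>\<omega>. indicator A \<omega> *\<^sub>R (norm (Z \<omega>))\<^sup>2)"
    using assms by (intro integrable_mult_indicator) (auto simp: square_integrable_def)
  also have "(\<lambda>\<omega>. indicator A \<omega> *\<^sub>R (norm (Z \<omega>))\<^sup>2) = (\<lambda>\<omega>. (norm (indicator A \<omega> *\<^sub>R Z \<omega>))\<^sup>2)"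
    by (auto simp: indicator_def)
  finally show ?thesis
    using assms(2) by (auto simp: square_integrable_def)
qed

lemma square_integrable_mean:
  fixes Z :: "'m::finite \<Rightarrow> 'w \<Rightarrow> 'a::euclidean_space"
  assumes "\<And>i. square_integrable M (Z i)"
  shows "square_integrable M (\<lambda>\<omega>. mean (\<lambda>i. Z i \<omega>))"
  unfolding mean_def by (intro square_integrable_scaleR square_integrable_sum assms)

text \<open>Polarisation expresses the inner product through three squared norms.\<close>

lemma integrable_inner:
  fixes X Y :: "'w \<Rightarrow> 'a::euclidean_space"
  assumes "square_integrable M X" "square_integrable M Y"
  shows "integrable M (\<lambda>\<omega>. inner (X \<omega>) (Y \<omega>))"
proof -
  have "inner (X \<omega>) (Y \<omega>) = ((norm (X \<omega> + Y \<omega>))\<^sup>2 - (norm (X \<omega>))\<^sup>2 - (norm (Y \<omega>))\<^sup>2) / 2" for \<omega>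
    by (simp add: power2_norm_eq_inner inner_add_left inner_add_right inner_commute)
  moreover have "integrable M (\<lambda>\<omega>. ((norm (X \<omega> + Y \<omega>))\<^sup>2 - (norm (X \<omega>))\<^sup>2 - (norm (Y \<omega>))\<^sup>2) / 2)"
    using square_integrable_add[OF assms] assms by (simp add: square_integrable_def)
  ultimately show ?thesis by presburger
qed

lemma integrable_dispersion:
  fixes Z :: "'m::finite \<Rightarrow> 'w \<Rightarrow> 'a::euclidean_space"
  assumes "\<And>i. square_integrable M (Z i)"
  shows "integrable M (\<lambda>\<omega>. dispersion (\<lambda>i. Z i \<omega>))"
  unfolding dispersion_def
  by (intro Bochner_Integration.integrable_sum square_integrable_norm square_integrable_diff square_integrable_mean assms)

lemma (in finite_measure) square_integrable_lipschitz:
  fixes h :: "'b::euclidean_space \<Rightarrow> 'c::euclidean_space"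
  assumes lip: "\<And>u v. norm (h u - h v) \<le> C * norm (u - v)" and Z: "square_integrable M Z"
  shows "square_integrable M (\<lambda>\<omega>. h (Z \<omega>))"
proof -
  have [measurable]: "Z \<in> borel_measurable M" using Z by (rule square_integrable_measurable)
  have [measurable]: "h \<in> borel_measurable borel"
  proof (rule borel_measurable_continuous_onI)
    \<comment> \<open>The sign of \<open>C\<close> is not given, while a Lipschitz constant has to
      be nonnegative.\<close>
    have "(max C 0)-lipschitz_on UNIV h"
    proof (rule lipschitz_onI)
      show "dist (h x) (h y) \<le> max C 0 * dist x y" for x y
        using order_trans[OF lip[of x y] mult_right_mono[of C "max C 0" "norm (x - y)"]]
        by (simp add: dist_norm)
    qed simp
    then show "continuous_on UNIV h" by (rule lipschitz_on_continuous_on)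
  qed
  have "square_integrable M (\<lambda>\<omega>. h (Z \<omega>) - h 0)"
    unfolding square_integrable_def
  proof
    show "integrable M (\<lambda>\<omega>. (norm (h (Z \<omega>) - h 0))\<^sup>2)"
    proof (rule Bochner_Integration.integrable_bound)
      show "integrable M (\<lambda>\<omega>. C\<^sup>2 * (norm (Z \<omega>))\<^sup>2)"
        using Z by (simp add: square_integrable_def)
      have "(norm (h (Z \<omega>) - h 0))\<^sup>2 \<le> C\<^sup>2 * (norm (Z \<omega>))\<^sup>2" for \<omega>
        using power_mono[OF lip[of "Z \<omega>" 0], of 2] by (simp add: power_mult_distrib)
      then show "AE \<omega> in M. norm ((norm (h (Z \<omega>) - h 0))\<^sup>2) \<le> norm (C\<^sup>2 * (norm (Z \<omega>))\<^sup>2)"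
        by auto
    qed measurable
  qed measurable
  from square_integrable_add[OF this square_integrable_const[of "h 0"]] show ?thesis by simp
qed

subsection \<open>The stochastic iteration\<close>

lemma borel_measurable_component:
  fixes Y :: "'w \<Rightarrow> real ^ 'd"
  assumes [measurable]: "Y \<in> borel_measurable N"
  shows "(\<lambda>\<omega>. Y \<omega> $ c) \<in> borel_measurable N"
proof -
  have "(\<lambda>\<omega>. inner (Y \<omega>) (axis c 1)) \<in> borel_measurable N" by measurable
  then show ?thesis by (simp add: inner_axis)
qed

lemma square_integrable_component:
  fixes Y :: "'w \<Rightarrow> real ^ 'd"
  assumes "square_integrable M Y"
  shows "square_integrable M (\<lambda>\<omega>. Y \<omega> $ c)"
proof -
  have [measurable]: "(\<lambda>\<omega>. Y \<omega> $ c) \<in> borel_measurable M"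
    by (intro borel_measurable_component square_integrable_measurable assms)
  then have meas: "(\<lambda>\<omega>. (norm (Y \<omega> $ c))\<^sup>2) \<in> borel_measurable M" by measurable
  have "(norm (Y \<omega> $ c))\<^sup>2 \<le> (norm (Y \<omega>))\<^sup>2" for \<omega>
    using component_le_norm_cart[of "Y \<omega>" c] by (intro power_mono) auto
  then have "integrable M (\<lambda>\<omega>. (norm (Y \<omega> $ c))\<^sup>2)"
    by (intro Bochner_Integration.integrable_bound[OF square_integrable_norm[OF assms] meas]) simp
  then show ?thesis by (simp add: square_integrable_def)
qed

locale consensus_run = prob_space M + consensus_problem f g W L
  for M :: "'w measure"
    and f :: "'m::finite \<Rightarrow> real ^ 'd \<Rightarrow> real"
    and g :: "'m \<Rightarrow> real ^ 'd \<Rightarrow> real ^ 'd"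
    and W :: "real ^ 'm ^ 'm"
    and L :: real +
  fixes \<gamma> lam :: "nat \<Rightarrow> real"
    and \<sigma> :: "nat \<Rightarrow> 'm \<Rightarrow> real"
    and \<zeta> x :: "nat \<Rightarrow> 'm \<Rightarrow> 'w \<Rightarrow> real ^ 'd"
  assumes gamma_pos: "\<And>k. \<gamma> k > 0"
    and gamma_lim: "\<gamma> \<longlonglongrightarrow> 0"
    and algorithm: "static_consensus M W \<gamma> lam g \<zeta> x"
    and noise: "noise_moments M x \<zeta> \<sigma>"
    and noise_past: "noise_memoryless M x \<zeta>"
    and noise_summable: "summable (\<lambda>k. (\<gamma> k)\<^sup>2 * (MAX i. (\<sigma> k i)\<^sup>2))"
    and init: "\<And>i. square_integrable M (x 0 i)"
    and lam_nonneg: "\<And>k. lam k \<ge> 0"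
    and gamma_sum: "\<not> summable \<gamma>"
    and lam_sum: "\<not> summable lam"
    and ratio_sum: "summable (\<lambda>k. (lam k)\<^sup>2 / \<gamma> k)"
begin

definition fluctuation :: "nat \<Rightarrow> 'w \<Rightarrow> 'm \<Rightarrow> real ^ 'd" where
  "fluctuation k \<omega> i = (\<Sum>j\<in>in_nbrs W i. W $ i $ j *\<^sub>R \<zeta> k j \<omega>)"

text \<open>The next states with the noise left out, so these are positions and not
  increments.\<close>

definition drift :: "nat \<Rightarrow> 'w \<Rightarrow> 'm \<Rightarrow> real ^ 'd" where
  "drift k \<omega> = mean_step (\<gamma> k) (lam k) (\<lambda>i. x k i \<omega>)"

lemma update:
  assumes "\<omega> \<in> space M"
  shows "x (Suc k) i \<omega> = drift k \<omega> i + \<gamma> k *\<^sub>R fluctuation k \<omega> i"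
proof -
  have "x (Suc k) i \<omega> = x k i \<omega>
      + (\<Sum>j\<in>in_nbrs W i. (\<gamma> k * W $ i $ j) *\<^sub>R (x k j \<omega> + \<zeta> k j \<omega> - x k i \<omega>))
      - lam k *\<^sub>R g i (x k i \<omega>)"
    using algorithm assms unfolding static_consensus_def by blast
  also have "(\<Sum>j\<in>in_nbrs W i. (\<gamma> k * W $ i $ j) *\<^sub>R (x k j \<omega> + \<zeta> k j \<omega> - x k i \<omega>))
      = (\<Sum>j\<in>in_nbrs W i. (\<gamma> k * W $ i $ j) *\<^sub>R (x k j \<omega> - x k i \<omega>)) + \<gamma> k *\<^sub>R fluctuation k \<omega> i"
    by (simp add: fluctuation_def scaleR_sum_right sum.distrib[symmetric] algebra_simps)
  finally show ?thesis
    by (simp add: drift_def mean_step_def consensus_step_def)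
qed

lemma noise_measurable [measurable]: "\<zeta> k i \<in> borel_measurable M"
  using noise by (simp add: noise_moments_def)

lemma finite_measure_subalgebra_state:
  assumes "x k i \<in> borel_measurable M"
  shows "finite_measure_subalgebra M (state_algebra M (x k i))"
proof
  show "subalgebra M (state_algebra M (x k i))"
    unfolding state_algebra_def
    using measurable_sets[OF assms] by (auto simp: subalgebra_def sets_vimage_algebra2)
qed

text \<open>Integrating the conditional second moment. It takes values in
  \<open>[0, \<infinity>]\<close>, so this needs no prior integrability, and square integrability of
  the noise follows from it.\<close>

lemma noise_second_moment:
  assumes "x k i \<in> borel_measurable M"
  shows "(\<integral>\<^sup>+\<omega>. ennreal ((norm (\<zeta> k i \<omega>))\<^sup>2) \<partial>M) = ennreal ((\<sigma> k i)\<^sup>2)"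
proof -
  interpret S: finite_measure_subalgebra M "state_algebra M (x k i)"
    by (rule finite_measure_subalgebra_state[OF assms])
  have "(\<integral>\<^sup>+\<omega>. ennreal ((norm (\<zeta> k i \<omega>))\<^sup>2) \<partial>M)
      = (\<integral>\<^sup>+\<omega>. 1 * nn_cond_exp M (state_algebra M (x k i)) (\<lambda>\<omega>. ennreal ((norm (\<zeta> k i \<omega>))\<^sup>2)) \<omega> \<partial>M)"
    by (subst S.nn_cond_exp_intg) auto
  also have "\<dots> = (\<integral>\<^sup>+\<omega>. ennreal ((\<sigma> k i)\<^sup>2) \<partial>M)"
    using noise by (intro nn_integral_cong_AE) (simp add: noise_moments_def)
  finally show ?thesis
    by (simp add: emeasure_space_1)
qed

lemma square_integrable_noise:
  assumes "x k i \<in> borel_measurable M"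
  shows "square_integrable M (\<zeta> k i)" "expectation (\<lambda>\<omega>. (norm (\<zeta> k i \<omega>))\<^sup>2) = (\<sigma> k i)\<^sup>2"
proof -
  show *: "square_integrable M (\<zeta> k i)"
    unfolding square_integrable_def using noise_second_moment[OF assms]
    by (auto intro!: integrableI_nonneg)
  show "expectation (\<lambda>\<omega>. (norm (\<zeta> k i \<omega>))\<^sup>2) = (\<sigma> k i)\<^sup>2"
    using noise_second_moment[OF assms] nn_integral_eq_integral[OF square_integrable_norm[OF *]]
    by simp
qed

lemma square_integrable_drift:
  assumes "\<And>i. square_integrable M (x k i)"
  shows "square_integrable M (\<lambda>\<omega>. drift k \<omega> i)"
  unfolding drift_def mean_step_def consensus_step_def
  by (intro square_integrable_diff square_integrable_add square_integrable_sum square_integrable_scaleR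
      square_integrable_lipschitz[OF grad_lipschitz] assms)

text \<open>Measurability and second moments advance together: the noise at \<open>k\<close> is
  known to be square integrable only once the states at \<open>k\<close> are measurable, because
  only then is \<open>state_algebra\<close> a subalgebra. For this reason the preceding noise lemmas
  carry measurability as a premise.\<close>

lemma square_integrable_state: "square_integrable M (x k i)"
proof (induction k arbitrary: i)
  case 0
  show ?case by (rule init)
next
  case (Suc k)
  have "square_integrable M (\<lambda>\<omega>. drift k \<omega> i + \<gamma> k *\<^sub>R fluctuation k \<omega> i)"
    unfolding fluctuation_def
    by (intro square_integrable_add square_integrable_drift square_integrable_scaleR square_integrable_sum
        square_integrable_noise square_integrable_measurable Suc)
  then show ?case
    unfolding square_integrable_def
    by (simp add: update cong: measurable_cong Bochner_Integration.integrable_cong)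
qed

lemmas state_measurable [measurable] = square_integrable_measurable[OF square_integrable_state]
lemmas square_integrable_zeta = square_integrable_noise(1)[OF state_measurable]
lemmas expectation_noise = square_integrable_noise(2)[OF state_measurable]

lemma square_integrable_fluctuation: "square_integrable M (\<lambda>\<omega>. fluctuation k \<omega> i)"
  unfolding fluctuation_def
  by (intro square_integrable_scaleR square_integrable_sum square_integrable_zeta)

section \<open>The filtration of the states and the centered noise\<close>

abbreviation history :: "nat \<Rightarrow> 'w measure" where
  "history \<equiv> history_algebra M x"

lemma history_generators:
  "(\<Union>l\<in>{..k}. \<Union>i. sets (state_algebra M (x l i))) \<subseteq> sets M"
  unfolding state_algebra_def
  using measurable_sets[OF state_measurable] by (auto simp: sets_vimage_algebra2)

lemma space_history: "space (history k) = space M"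
  unfolding history_algebra_def
  using history_generators[of k] sets.space_closed[of M] by (intro space_measure_of) auto

lemma sets_history:
  "sets (history k) = sigma_sets (space M) (\<Union>l\<in>{..k}. \<Union>i. sets (state_algebra M (x l i)))"
  unfolding history_algebra_def
  using history_generators[of k] sets.space_closed[of M] by (intro sets_measure_of) auto

lemma subalgebra_history: "subalgebra M (history k)"
  unfolding subalgebra_def space_history sets_history
  using sets.sigma_sets_subset[OF history_generators] by simp

lemma history_mono: "sets (history k) \<subseteq> sets (history (Suc k))"
  unfolding sets_history by (intro sigma_sets_mono') (force simp: le_Suc_eq)

lemma state_history_measurable:
  assumes "l \<le> k"
  shows "x l i \<in> borel_measurable (history k)"
proof (rule measurableI)
  fix A :: "(real ^ 'd) set" assume "A \<in> sets borel"
  then have "x l i -` A \<inter> space M \<in> sets (state_algebra M (x l i))"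
    by (auto simp: state_algebra_def sets_vimage_algebra2)
  then have "x l i -` A \<inter> space M \<in> (\<Union>l\<in>{..k}. \<Union>i. sets (state_algebra M (x l i)))"
    using assms by blast
  then show "x l i -` A \<inter> space (history k) \<in> sets (history k)"
    unfolding space_history sets_history by (rule sigma_sets.Basic)
qed simp

text \<open>The memoryless condition carries the zero conditional mean from the agent's own state
  over to the whole history. A factor known from the history can then be pulled out of the
  conditional expectation, one coordinate at a time.\<close>

lemma expectation_inner_noise:
  assumes Z [measurable]: "Z \<in> borel_measurable (history k)" and sq: "square_integrable M Z"
  shows "expectation (\<lambda>\<omega>. inner (Z \<omega>) (\<zeta> k j \<omega>)) = 0"
proof -
  interpret H: finite_measure_subalgebra M "history k"
    by unfold_locales (rule subalgebra_history)
  have "AE \<omega> in M. vec_cond_exp M (history k) (\<zeta> k j) \<omega> = 0"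
  proof -
    have "AE \<omega> in M. vec_cond_exp M (history k) (\<zeta> k j) \<omega> = vec_cond_exp M (state_algebra M (x k j)) (\<zeta> k j) \<omega>"
      using noise_past by (simp add: noise_memoryless_def)
    moreover have "AE \<omega> in M. vec_cond_exp M (state_algebra M (x k j)) (\<zeta> k j) \<omega> = 0"
      using noise by (simp add: noise_moments_def)
    ultimately show ?thesis by eventually_elim simp
  qed
  then have zero: "AE \<omega> in M. real_cond_exp M (history k) (\<lambda>\<omega>. \<zeta> k j \<omega> $ c) \<omega> = 0" for c
    by eventually_elim (auto simp: vec_cond_exp_def vec_eq_iff)
  have int: "integrable M (\<lambda>\<omega>. Z \<omega> $ c * \<zeta> k j \<omega> $ c)" for c
    using integrable_inner[OF square_integrable_component[OF sq] square_integrable_component[OF square_integrable_zeta]] by simp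
  have "expectation (\<lambda>\<omega>. Z \<omega> $ c * \<zeta> k j \<omega> $ c) = 0" for c
  proof -
    have "expectation (\<lambda>\<omega>. Z \<omega> $ c * \<zeta> k j \<omega> $ c)
        = expectation (\<lambda>\<omega>. Z \<omega> $ c * real_cond_exp M (history k) (\<lambda>\<omega>. \<zeta> k j \<omega> $ c) \<omega>)"
      by (rule H.real_cond_exp_intg(2)[symmetric, OF int borel_measurable_component[OF Z]
          borel_measurable_component[OF noise_measurable]])
    also have "\<dots> = expectation (\<lambda>_. 0)"
    proof (rule integral_cong_AE)
      have [measurable]: "(\<lambda>\<omega>. Z \<omega> $ c) \<in> borel_measurable M"
        by (rule measurable_from_subalg[OF subalgebra_history borel_measurable_component[OF Z]])
      show "(\<lambda>\<omega>. Z \<omega> $ c * real_cond_exp M (history k) (\<lambda>\<omega>. \<zeta> k j \<omega> $ c) \<omega>) \<in> borel_measurable M"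
        by measurable
    qed (use zero[of c] in auto)
    finally show ?thesis by simp
  qed
  then show ?thesis
    using int by (simp add: inner_vec_def Bochner_Integration.integral_sum)
qed

lemma expectation_inner_fluctuation:
  assumes "Z \<in> borel_measurable (history k)" "square_integrable M Z"
  shows "expectation (\<lambda>\<omega>. inner (Z \<omega>) (fluctuation k \<omega> i)) = 0"
  using assms
  by (simp add: fluctuation_def inner_sum_right Bochner_Integration.integral_sum integrable_inner
      square_integrable_zeta expectation_inner_noise)

definition noise_power :: "nat \<Rightarrow> real" where
  "noise_power k = expectation (\<lambda>\<omega>. \<Sum>i\<in>UNIV. (norm (fluctuation k \<omega> i))\<^sup>2)"

lemma integrable_fluctuation: "integrable M (\<lambda>\<omega>. \<Sum>i\<in>UNIV. (norm (fluctuation k \<omega> i))\<^sup>2)"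
  by (intro Bochner_Integration.integrable_sum square_integrable_norm square_integrable_fluctuation)

lemma noise_power_nonneg: "0 \<le> noise_power k"
  by (simp add: noise_power_def sum_nonneg)

text \<open>The noises of different agents may be dependent at the same time, so Cauchy-Schwarz is
  used in place of orthogonality. It gives the squared Frobenius norm of \<open>W\<close>; the
  factor \<open>CARD('m)\<close> in \<open>C\<close> comes from bounding each variance by the
  maximum.\<close>

lemma summable_noise_power: "summable (\<lambda>k. (\<gamma> k)\<^sup>2 * noise_power k)"
proof -
  define C where "C = (\<Sum>i\<in>UNIV. \<Sum>j\<in>UNIV. (W $ i $ j)\<^sup>2) * real CARD('m)"
  have fluct: "(\<Sum>i\<in>UNIV. (norm (fluctuation k \<omega> i))\<^sup>2) \<le> (\<Sum>i\<in>UNIV. \<Sum>j\<in>UNIV. (W $ i $ j)\<^sup>2) * (\<Sum>j\<in>UNIV. (norm (\<zeta> k j \<omega>))\<^sup>2)" for k \<omega>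
  proof -
    have "(norm (fluctuation k \<omega> i))\<^sup>2 \<le> (\<Sum>j\<in>UNIV. (W $ i $ j)\<^sup>2) * (\<Sum>j\<in>UNIV. (norm (\<zeta> k j \<omega>))\<^sup>2)" for i
    proof -
      have "norm (fluctuation k \<omega> i) \<le> (\<Sum>j\<in>in_nbrs W i. \<bar>W $ i $ j\<bar> * norm (\<zeta> k j \<omega>))"
        unfolding fluctuation_def by (rule sum_norm_le) simp
      also have "\<dots> \<le> (\<Sum>j\<in>UNIV. \<bar>W $ i $ j\<bar> * norm (\<zeta> k j \<omega>))"
        by (intro sum_mono2) auto
      also have "\<dots> \<le> L2_set (\<lambda>j. W $ i $ j) UNIV * L2_set (\<lambda>j. norm (\<zeta> k j \<omega>)) UNIV"
        using L2_set_mult_ineq[where A = UNIV and f = "\<lambda>j. W $ i $ j" and g = "\<lambda>j. norm (\<zeta> k j \<omega>)"] by simp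
      finally have "(norm (fluctuation k \<omega> i))\<^sup>2 \<le> (L2_set (\<lambda>j. W $ i $ j) UNIV * L2_set (\<lambda>j. norm (\<zeta> k j \<omega>)) UNIV)\<^sup>2"
        by (intro power_mono) auto
      also have "\<dots> = (\<Sum>j\<in>UNIV. (W $ i $ j)\<^sup>2) * (\<Sum>j\<in>UNIV. (norm (\<zeta> k j \<omega>))\<^sup>2)"
        by (simp add: L2_set_def power_mult_distrib sum_nonneg)
      finally show ?thesis .
    qed
    from sum_mono[OF this] show ?thesis
      by (simp only: sum_distrib_right)
  qed
  have "noise_power k \<le> C * (MAX i. (\<sigma> k i)\<^sup>2)" for k
  proof -
    have "noise_power k \<le> expectation (\<lambda>\<omega>. (\<Sum>i\<in>UNIV. \<Sum>j\<in>UNIV. (W $ i $ j)\<^sup>2) * (\<Sum>j\<in>UNIV. (norm (\<zeta> k j \<omega>))\<^sup>2))"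
      unfolding noise_power_def
      by (intro integral_mono integrable_fluctuation fluct integrable_mult_right Bochner_Integration.integrable_sum
          square_integrable_norm square_integrable_zeta)
    also have "\<dots> = (\<Sum>i\<in>UNIV. \<Sum>j\<in>UNIV. (W $ i $ j)\<^sup>2) * (\<Sum>j\<in>UNIV. (\<sigma> k j)\<^sup>2)"
      by (simp add: Bochner_Integration.integral_sum square_integrable_norm square_integrable_zeta expectation_noise)
    also have "\<dots> \<le> (\<Sum>i\<in>UNIV. \<Sum>j\<in>UNIV. (W $ i $ j)\<^sup>2) * (\<Sum>j\<in>(UNIV::'m set). MAX i. (\<sigma> k i)\<^sup>2)"
      by (intro mult_left_mono sum_mono Max_ge) (auto simp: sum_nonneg)
    finally show ?thesis by (simp add: C_def mult.assoc)
  qed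
  then have "(\<gamma> k)\<^sup>2 * noise_power k \<le> C * ((\<gamma> k)\<^sup>2 * (MAX i. (\<sigma> k i)\<^sup>2))" for k
    using mult_left_mono[of "noise_power k" "C * (MAX i. (\<sigma> k i)\<^sup>2)" "(\<gamma> k)\<^sup>2"] by (simp add: ac_simps)
  then show ?thesis
    by (intro summable_comparison_test'[OF summable_mult[OF noise_summable, of C]])
      (simp add: noise_power_nonneg)
qed


section \<open>Disagreement and distance as adapted processes\<close>

definition disagreement :: "nat \<Rightarrow> 'w \<Rightarrow> real" where
  "disagreement k \<omega> = dispersion (\<lambda>i. x k i \<omega>)"

definition distance :: "real ^ 'd \<Rightarrow> nat \<Rightarrow> 'w \<Rightarrow> real" where
  "distance \<theta> k \<omega> = (norm (mean (\<lambda>i. x k i \<omega>) - \<theta>))\<^sup>2"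

definition excess :: "real ^ 'd \<Rightarrow> nat \<Rightarrow> 'w \<Rightarrow> real" where
  "excess \<theta> k \<omega> = lam k * (objective f (mean (\<lambda>i. x k i \<omega>)) - objective f \<theta>)"

lemma disagreement_nonneg: "0 \<le> disagreement k \<omega>"
  by (simp add: disagreement_def dispersion_nonneg)

lemma distance_nonneg: "0 \<le> distance \<theta> k \<omega>"
  by (simp add: distance_def)

lemma excess_nonneg: "optimal_solution (objective f) \<theta> \<Longrightarrow> 0 \<le> excess \<theta> k \<omega>"
  using lam_nonneg by (simp add: excess_def optimal_solution_def is_arg_min_linorder)

lemma lyapunov_eq: "lyapunov \<theta> (\<lambda>i. x k i \<omega>) = 1 + disagreement k \<omega> + distance \<theta> k \<omega>"
  by (simp add: lyapunov_def disagreement_def distance_def)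

lemma adapted:
  "(\<lambda>\<omega>. mean (\<lambda>i. x k i \<omega>)) \<in> borel_measurable (history k)"
  "disagreement k \<in> borel_measurable (history k)"
  "distance \<theta> k \<in> borel_measurable (history k)"
  "(\<lambda>\<omega>. drift k \<omega> i) \<in> borel_measurable (history k)"
  "excess \<theta> k \<in> borel_measurable (history k)"
proof -
  note [measurable] = state_history_measurable[OF order_refl]
  show [measurable]: "(\<lambda>\<omega>. mean (\<lambda>i. x k i \<omega>)) \<in> borel_measurable (history k)"
    unfolding mean_def by measurable
  show "disagreement k \<in> borel_measurable (history k)"
    unfolding disagreement_def[abs_def] dispersion_def by measurable
  show "distance \<theta> k \<in> borel_measurable (history k)"
    unfolding distance_def[abs_def] by measurable
  have [measurable]: "g i \<in> borel_measurable borel" for i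
  proof (rule borel_measurable_continuous_onI)
    have "L-lipschitz_on UNIV (g i)"
      using L_pos grad_lipschitz by (intro lipschitz_onI) (auto simp: dist_norm)
    then show "continuous_on UNIV (g i)" by (rule lipschitz_on_continuous_on)
  qed
  show "(\<lambda>\<omega>. drift k \<omega> i) \<in> borel_measurable (history k)"
    unfolding drift_def mean_step_def consensus_step_def by measurable
  have [measurable]: "objective f \<in> borel_measurable borel"
    by (intro borel_measurable_continuous_onI continuous_objective)
  show "excess \<theta> k \<in> borel_measurable (history k)"
    unfolding excess_def[abs_def] by measurable
qed

lemmas history_imp_measurable = measurable_from_subalg[OF subalgebra_history]

lemma integrable_disagreement: "integrable M (disagreement k)"
  unfolding disagreement_def[abs_def] by (intro integrable_dispersion square_integrable_state)

lemma integrable_distance: "integrable M (distance \<theta> k)"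
  unfolding distance_def[abs_def]
  by (intro square_integrable_norm square_integrable_diff square_integrable_mean square_integrable_state square_integrable_const)

lemmas square_integrable_drift' = square_integrable_drift[OF square_integrable_state]

lemma integrable_drift:
  "integrable M (\<lambda>\<omega>. dispersion (drift k \<omega>))"
  "integrable M (\<lambda>\<omega>. (norm (mean (drift k \<omega>) - \<theta>))\<^sup>2)"
proof -
  show "integrable M (\<lambda>\<omega>. dispersion (drift k \<omega>))"
    using integrable_dispersion[of M "\<lambda>i \<omega>. drift k \<omega> i"] square_integrable_drift' by simp
  have "square_integrable M (\<lambda>\<omega>. mean (drift k \<omega>))"
    using square_integrable_mean[of M "\<lambda>i \<omega>. drift k \<omega> i"] square_integrable_drift' by simp
  then show "integrable M (\<lambda>\<omega>. (norm (mean (drift k \<omega>) - \<theta>))\<^sup>2)"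
    by (intro square_integrable_norm square_integrable_diff square_integrable_const)
qed

lemma integrable_indicator_mult:
  fixes Y :: "'w \<Rightarrow> real"
  assumes "A \<in> sets M" "integrable M Y"
  shows "integrable M (\<lambda>\<omega>. indicator A \<omega> * Y \<omega>)"
  using integrable_mult_indicator[OF assms] by simp

lemma indicator_mult_le:
  fixes Y :: "'w \<Rightarrow> real"
  assumes "A \<in> sets M" "integrable M Y" "\<And>\<omega>. 0 \<le> Y \<omega>"
  shows "expectation (\<lambda>\<omega>. indicator A \<omega> * Y \<omega>) \<le> expectation Y"
  using assms by (intro integral_mono integrable_indicator_mult) (auto simp: indicator_def)

lemma sets_history_imp_events: "A \<in> sets (history k) \<Longrightarrow> A \<in> sets M"
  using subalgebra_history by (auto simp: subalgebra_def)

text \<open>The indicator of a history event can be absorbed into \<open>Z\<close>, which stays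
  measurable for the history and square integrable.\<close>

lemma expectation_orthogonal:
  assumes A: "A \<in> sets (history k)"
    and Z: "Z \<in> borel_measurable (history k)" "square_integrable M Z"
  shows "integrable M (\<lambda>\<omega>. indicator A \<omega> * inner (Z \<omega>) (fluctuation k \<omega> i))"
    "expectation (\<lambda>\<omega>. indicator A \<omega> * inner (Z \<omega>) (fluctuation k \<omega> i)) = 0"
proof -
  note sq = square_integrable_indicator[OF Z(2) sets_history_imp_events[OF A]]
  have "(\<lambda>\<omega>. indicator A \<omega> *\<^sub>R Z \<omega>) \<in> borel_measurable (history k)"
    using A Z by (intro borel_measurable_scaleR borel_measurable_indicator) auto
  from expectation_inner_fluctuation[OF this sq, of i]
  show "expectation (\<lambda>\<omega>. indicator A \<omega> * inner (Z \<omega>) (fluctuation k \<omega> i)) = 0" by simp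
  show "integrable M (\<lambda>\<omega>. indicator A \<omega> * inner (Z \<omega>) (fluctuation k \<omega> i))"
    using integrable_inner[OF sq square_integrable_fluctuation, of k i] by simp
qed

text \<open>These are the vectors paired with the noise when the disagreement and the distance after
  one iteration are expanded.\<close>

lemma deviation_admissible:
  "(\<lambda>\<omega>. drift k \<omega> i - mean (drift k \<omega>)) \<in> borel_measurable (history k)"
  "square_integrable M (\<lambda>\<omega>. drift k \<omega> i - mean (drift k \<omega>))"
  "(\<lambda>\<omega>. mean (drift k \<omega>) - \<theta>) \<in> borel_measurable (history k)"
  "square_integrable M (\<lambda>\<omega>. mean (drift k \<omega>) - \<theta>)"
proof -
  note [measurable] = adapted(4)
  have sq: "square_integrable M (\<lambda>\<omega>. mean (drift k \<omega>))"
    using square_integrable_mean[of M "\<lambda>i \<omega>. drift k \<omega> i"] square_integrable_drift' by simp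
  show "(\<lambda>\<omega>. drift k \<omega> i - mean (drift k \<omega>)) \<in> borel_measurable (history k)"
    unfolding mean_def by measurable
  show "(\<lambda>\<omega>. mean (drift k \<omega>) - \<theta>) \<in> borel_measurable (history k)"
    unfolding mean_def by measurable
  show "square_integrable M (\<lambda>\<omega>. drift k \<omega> i - mean (drift k \<omega>))"
    "square_integrable M (\<lambda>\<omega>. mean (drift k \<omega>) - \<theta>)"
    using sq by (auto intro!: square_integrable_diff square_integrable_drift' square_integrable_const)
qed

text \<open>The common shape of both expansions: a noiseless part, a linear noise part that averages
  out, and a quadratic noise part.\<close>

lemma expectation_add_centered:
  fixes p q r :: "'w \<Rightarrow> real"
  assumes "A \<in> sets M" "integrable M p" "integrable M r"
    and "\<And>i. integrable M (\<lambda>\<omega>. indicator A \<omega> * s i \<omega>)"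
    and "\<And>i. expectation (\<lambda>\<omega>. indicator A \<omega> * s i \<omega>) = 0"
  shows "expectation (\<lambda>\<omega>. indicator A \<omega> * p \<omega> + a * (\<Sum>i\<in>UNIV. indicator A \<omega> * s (i::'m) \<omega>) + b * (indicator A \<omega> * r \<omega>))
    = expectation (\<lambda>\<omega>. indicator A \<omega> * p \<omega>) + b * expectation (\<lambda>\<omega>. indicator A \<omega> * r \<omega>)"
proof -
  define S where "S \<omega> = (\<Sum>i\<in>UNIV. indicator A \<omega> * s i \<omega>)" for \<omega>
  have "integrable M S" "expectation S = 0"
    unfolding S_def[abs_def] using assms by (auto simp only: Bochner_Integration.integral_sum sum.neutral_const)
  then show ?thesis
    unfolding S_def[symmetric] using integrable_indicator_mult[OF assms(1)] assms(2,3) by simp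
qed

text \<open>By \<open>dispersion_add_scaleR\<close> the noise enters linearly, paired with
  deviations known from the history, and quadratically. The linear part vanishes in expectation even
  on \<open>A\<close>; the quadratic part is enlarged from \<open>A\<close> to the whole
  space.\<close>

lemma disagreement_Suc_le:
  assumes A: "A \<in> sets (history k)"
  shows "expectation (\<lambda>\<omega>. indicator A \<omega> * disagreement (Suc k) \<omega>)
    \<le> expectation (\<lambda>\<omega>. indicator A \<omega> * dispersion (drift k \<omega>)) + (\<gamma> k)\<^sup>2 * noise_power k"
proof -
  note AM = sets_history_imp_events[OF A]
  have fl: "integrable M (\<lambda>\<omega>. dispersion (fluctuation k \<omega>))"
    using integrable_dispersion[of M "\<lambda>i \<omega>. fluctuation k \<omega> i"] square_integrable_fluctuation by simp
  have "expectation (\<lambda>\<omega>. indicator A \<omega> * disagreement (Suc k) \<omega>)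
      = expectation (\<lambda>\<omega>. indicator A \<omega> * dispersion (drift k \<omega>)
        + 2 * \<gamma> k * (\<Sum>i\<in>UNIV. indicator A \<omega> * inner (drift k \<omega> i - mean (drift k \<omega>)) (fluctuation k \<omega> i))
        + (\<gamma> k)\<^sup>2 * (indicator A \<omega> * dispersion (fluctuation k \<omega>)))"
  proof (rule Bochner_Integration.integral_cong[OF refl])
    fix \<omega> assume "\<omega> \<in> space M"
    then have "disagreement (Suc k) \<omega> = dispersion (\<lambda>i. drift k \<omega> i + \<gamma> k *\<^sub>R fluctuation k \<omega> i)"
      by (simp add: disagreement_def update)
    then show "indicator A \<omega> * disagreement (Suc k) \<omega> = indicator A \<omega> * dispersion (drift k \<omega>)
        + 2 * \<gamma> k * (\<Sum>i\<in>UNIV. indicator A \<omega> * inner (drift k \<omega> i - mean (drift k \<omega>)) (fluctuation k \<omega> i))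
        + (\<gamma> k)\<^sup>2 * (indicator A \<omega> * dispersion (fluctuation k \<omega>))"
      unfolding dispersion_add_scaleR mult.assoc sum_distrib_left[symmetric]
      by (simp add: algebra_simps)
  qed
  also have "\<dots> = expectation (\<lambda>\<omega>. indicator A \<omega> * dispersion (drift k \<omega>))
      + (\<gamma> k)\<^sup>2 * expectation (\<lambda>\<omega>. indicator A \<omega> * dispersion (fluctuation k \<omega>))"
    by (intro expectation_add_centered AM integrable_drift(1) fl
        expectation_orthogonal[OF A deviation_admissible(1,2)])
  also have "expectation (\<lambda>\<omega>. indicator A \<omega> * dispersion (fluctuation k \<omega>)) \<le> noise_power k"
    using indicator_mult_le[OF AM fl dispersion_nonneg] integral_mono[OF fl integrable_fluctuation dispersion_le]
    unfolding noise_power_def by (rule order_trans)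
  finally show ?thesis
    by (simp add: mult_left_mono)
qed

lemma distance_Suc_le:
  assumes A: "A \<in> sets (history k)"
  shows "expectation (\<lambda>\<omega>. indicator A \<omega> * distance \<theta> (Suc k) \<omega>)
    \<le> expectation (\<lambda>\<omega>. indicator A \<omega> * (norm (mean (drift k \<omega>) - \<theta>))\<^sup>2) + (\<gamma> k)\<^sup>2 * noise_power k"
proof -
  note AM = sets_history_imp_events[OF A]
  have fl: "integrable M (\<lambda>\<omega>. (norm (mean (fluctuation k \<omega>)))\<^sup>2)"
    using square_integrable_mean[of M "\<lambda>i \<omega>. fluctuation k \<omega> i"] square_integrable_fluctuation
    by (simp add: square_integrable_norm)
  have "expectation (\<lambda>\<omega>. indicator A \<omega> * distance \<theta> (Suc k) \<omega>)
      = expectation (\<lambda>\<omega>. indicator A \<omega> * (norm (mean (drift k \<omega>) - \<theta>))\<^sup>2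
        + 2 * \<gamma> k / real CARD('m) * (\<Sum>i\<in>UNIV. indicator A \<omega> * inner (mean (drift k \<omega>) - \<theta>) (fluctuation k \<omega> i))
        + (\<gamma> k)\<^sup>2 * (indicator A \<omega> * (norm (mean (fluctuation k \<omega>)))\<^sup>2))"
  proof (rule Bochner_Integration.integral_cong[OF refl])
    fix \<omega> assume "\<omega> \<in> space M"
    then have "mean (\<lambda>i. x (Suc k) i \<omega>) = mean (drift k \<omega>) + \<gamma> k *\<^sub>R mean (fluctuation k \<omega>)"
      by (simp add: update mean_add mean_scaleR)
    then have *: "distance \<theta> (Suc k) \<omega> = (norm ((mean (drift k \<omega>) - \<theta>) + \<gamma> k *\<^sub>R mean (fluctuation k \<omega>)))\<^sup>2"
      by (simp add: distance_def algebra_simps)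
    have **: "(norm (p + t *\<^sub>R q))\<^sup>2 = (norm p)\<^sup>2 + 2 * t * inner p q + t\<^sup>2 * (norm q)\<^sup>2" for p q :: "real ^ 'd" and t
      by (simp only: power2_norm_eq_inner)
        (simp add: inner_add_left inner_add_right inner_commute power2_eq_square algebra_simps)
    have ***: "inner p (mean (fluctuation k \<omega>)) = (\<Sum>i\<in>UNIV. inner p (fluctuation k \<omega> i)) / real CARD('m)" for p
      by (simp add: mean_def inner_sum_right divide_inverse mult.commute)
    show "indicator A \<omega> * distance \<theta> (Suc k) \<omega> = indicator A \<omega> * (norm (mean (drift k \<omega>) - \<theta>))\<^sup>2
        + 2 * \<gamma> k / real CARD('m) * (\<Sum>i\<in>UNIV. indicator A \<omega> * inner (mean (drift k \<omega>) - \<theta>) (fluctuation k \<omega> i))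
        + (\<gamma> k)\<^sup>2 * (indicator A \<omega> * (norm (mean (fluctuation k \<omega>)))\<^sup>2)"
      unfolding * ** *** sum_distrib_left[symmetric] by (simp add: algebra_simps)
  qed
  also have "\<dots> = expectation (\<lambda>\<omega>. indicator A \<omega> * (norm (mean (drift k \<omega>) - \<theta>))\<^sup>2)
      + (\<gamma> k)\<^sup>2 * expectation (\<lambda>\<omega>. indicator A \<omega> * (norm (mean (fluctuation k \<omega>)))\<^sup>2)"
    by (intro expectation_add_centered AM integrable_drift(2) fl
        expectation_orthogonal[OF A deviation_admissible(3,4)])
  also have "expectation (\<lambda>\<omega>. indicator A \<omega> * (norm (mean (fluctuation k \<omega>)))\<^sup>2) \<le> noise_power k"
    using indicator_mult_le[OF AM fl zero_le_power2] integral_mono[OF fl integrable_fluctuation norm_mean_le]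
    unfolding noise_power_def by (rule order_trans)
  finally show ?thesis
    by (simp add: mult_left_mono)
qed

section \<open>Expected one-step inequalities on events of the history\<close>

definition error :: "real ^ 'd \<Rightarrow> nat \<Rightarrow> real" where
  "error \<theta> k = step_const \<theta> * ((lam k)\<^sup>2 / \<gamma> k)"

lemma error_nonneg: "0 \<le> error \<theta> k"
  using step_const_nonneg gamma_pos[of k] by (simp add: error_def)

lemma summable_error: "summable (error \<theta>)"
  unfolding error_def[abs_def] by (intro summable_mult ratio_sum)

definition level :: "real ^ 'd \<Rightarrow> nat \<Rightarrow> real" where
  "level \<theta> k = 1 + expectation (disagreement k) + expectation (distance \<theta> k)"

lemma expectation_lyapunov:
  "integrable M (\<lambda>\<omega>. lyapunov \<theta> (\<lambda>i. x k i \<omega>))"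
  "expectation (\<lambda>\<omega>. lyapunov \<theta> (\<lambda>i. x k i \<omega>)) = level \<theta> k"
  unfolding lyapunov_eq level_def
  using integrable_disagreement integrable_distance by (auto simp: prob_space)

text \<open>The error is enlarged from \<open>A\<close> to the whole space, which turns it into a
  number independent of \<open>A\<close>. The contraction keeps its indicator: with
  \<open>A = space M\<close> it yields summability, and otherwise its sign allows dropping
  it.\<close>

lemma disagreement_drift_le:
  assumes A: "A \<in> sets (history k)" and \<gamma>: "\<gamma> k \<le> 1"
  shows "expectation (\<lambda>\<omega>. indicator A \<omega> * (disagreement (Suc k) \<omega> - disagreement k \<omega>))
    \<le> - spectral_gap * \<gamma> k * expectation (\<lambda>\<omega>. indicator A \<omega> * disagreement k \<omega>)
      + error \<theta> k * level \<theta> k + (\<gamma> k)\<^sup>2 * noise_power k"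
proof -
  note AM = sets_history_imp_events[OF A]
  note int = integrable_indicator_mult[OF AM]
  have "expectation (\<lambda>\<omega>. indicator A \<omega> * dispersion (drift k \<omega>))
    \<le> expectation (\<lambda>\<omega>. indicator A \<omega> * disagreement k \<omega> - spectral_gap * \<gamma> k * (indicator A \<omega> * disagreement k \<omega>)
      + error \<theta> k * (indicator A \<omega> * lyapunov \<theta> (\<lambda>i. x k i \<omega>)))"
  proof (rule integral_mono)
    fix \<omega>
    have "dispersion (drift k \<omega>) \<le> disagreement k \<omega> - spectral_gap * \<gamma> k * disagreement k \<omega>
        + error \<theta> k * lyapunov \<theta> (\<lambda>i. x k i \<omega>)"
      unfolding drift_def disagreement_def error_def
      by (rule dispersion_mean_step_le[OF gamma_pos \<gamma>])
    from mult_left_mono[OF this, of "indicator A \<omega>"]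
    show "indicator A \<omega> * dispersion (drift k \<omega>) \<le> indicator A \<omega> * disagreement k \<omega>
        - spectral_gap * \<gamma> k * (indicator A \<omega> * disagreement k \<omega>)
      + error \<theta> k * (indicator A \<omega> * lyapunov \<theta> (\<lambda>i. x k i \<omega>))"
      by (simp add: algebra_simps)
  qed (intro int integrable_drift Bochner_Integration.integrable_add Bochner_Integration.integrable_diff
      integrable_mult_right integrable_disagreement expectation_lyapunov)+
  also have "\<dots> = expectation (\<lambda>\<omega>. indicator A \<omega> * disagreement k \<omega>)
      - spectral_gap * \<gamma> k * expectation (\<lambda>\<omega>. indicator A \<omega> * disagreement k \<omega>)
      + error \<theta> k * expectation (\<lambda>\<omega>. indicator A \<omega> * lyapunov \<theta> (\<lambda>i. x k i \<omega>))"
    using int[OF integrable_disagreement[of k]] int[OF expectation_lyapunov(1)[of \<theta> k]] by simp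
  also have "expectation (\<lambda>\<omega>. indicator A \<omega> * lyapunov \<theta> (\<lambda>i. x k i \<omega>)) \<le> level \<theta> k"
    unfolding expectation_lyapunov(2)[symmetric] using lyapunov_ge(1) order_trans[OF zero_le_one]
    by (intro indicator_mult_le AM expectation_lyapunov) blast
  finally have "expectation (\<lambda>\<omega>. indicator A \<omega> * dispersion (drift k \<omega>))
    \<le> expectation (\<lambda>\<omega>. indicator A \<omega> * disagreement k \<omega>)
      - spectral_gap * \<gamma> k * expectation (\<lambda>\<omega>. indicator A \<omega> * disagreement k \<omega>) + error \<theta> k * level \<theta> k"
    by (simp add: mult_left_mono error_nonneg)
  moreover have "expectation (\<lambda>\<omega>. indicator A \<omega> * (disagreement (Suc k) \<omega> - disagreement k \<omega>))
    = expectation (\<lambda>\<omega>. indicator A \<omega> * disagreement (Suc k) \<omega>) - expectation (\<lambda>\<omega>. indicator A \<omega> * disagreement k \<omega>)"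
    using int[OF integrable_disagreement] by (simp add: right_diff_distrib)
  ultimately show ?thesis
    using disagreement_Suc_le[OF A] by simp
qed

lemma norm_mean_drift_le:
  assumes "\<gamma> k \<le> 1"
  shows "(norm (mean (drift k \<omega>) - \<theta>))\<^sup>2 \<le> distance \<theta> k \<omega> - 2 * excess \<theta> k \<omega>
    + spectral_gap / 2 * \<gamma> k * disagreement k \<omega> + error \<theta> k * lyapunov \<theta> (\<lambda>i. x k i \<omega>)"
  unfolding drift_def disagreement_def error_def distance_def excess_def
  using norm_mean_mean_step_le[OF gamma_pos assms lam_nonneg[of k], where u = "\<lambda>i. x k i \<omega>" and \<theta> = \<theta>]
  by (simp add: mult.assoc)

text \<open>The distance estimate read backwards: its left side is nonnegative, so the remaining
  terms, all integrable, dominate the nonnegative \<open>excess\<close>.\<close>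

lemma integrable_excess:
  assumes opt: "optimal_solution (objective f) \<theta>" and \<gamma>: "\<gamma> k \<le> 1"
  shows "integrable M (excess \<theta> k)"
proof (rule Bochner_Integration.integrable_bound)
  show "integrable M (\<lambda>\<omega>. distance \<theta> k \<omega> + spectral_gap / 2 * \<gamma> k * disagreement k \<omega>
      + error \<theta> k * lyapunov \<theta> (\<lambda>i. x k i \<omega>))"
    by (intro Bochner_Integration.integrable_add integrable_mult_right integrable_distance
        integrable_disagreement expectation_lyapunov)
  show "excess \<theta> k \<in> borel_measurable M"
    by (rule history_imp_measurable[OF adapted(5)])
  show "AE \<omega> in M. norm (excess \<theta> k \<omega>) \<le> norm (distance \<theta> k \<omega> + spectral_gap / 2 * \<gamma> k * disagreement k \<omega>
      + error \<theta> k * lyapunov \<theta> (\<lambda>i. x k i \<omega>))"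
  proof (rule AE_I2)
    fix \<omega>
    have "0 \<le> (norm (mean (drift k \<omega>) - \<theta>))\<^sup>2" by simp
    with norm_mean_drift_le[OF \<gamma>, of \<omega> \<theta>] excess_nonneg[OF opt, of k \<omega>]
    show "norm (excess \<theta> k \<omega>) \<le> norm (distance \<theta> k \<omega> + spectral_gap / 2 * \<gamma> k * disagreement k \<omega>
      + error \<theta> k * lyapunov \<theta> (\<lambda>i. x k i \<omega>))"
      unfolding real_norm_def by linarith
  qed
qed

text \<open>Here the disagreement term increases the distance, so it is enlarged from
  \<open>A\<close> to the whole space like the error. Only the decrease by \<open>excess\<close>
  still refers to \<open>A\<close>.\<close>

lemma distance_drift_le:
  assumes A: "A \<in> sets (history k)" and \<gamma>: "\<gamma> k \<le> 1" and opt: "optimal_solution (objective f) \<theta>"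
  shows "expectation (\<lambda>\<omega>. indicator A \<omega> * (distance \<theta> (Suc k) \<omega> - distance \<theta> k \<omega>))
    \<le> - 2 * expectation (\<lambda>\<omega>. indicator A \<omega> * excess \<theta> k \<omega>)
      + spectral_gap / 2 * \<gamma> k * expectation (disagreement k)
      + error \<theta> k * level \<theta> k + (\<gamma> k)\<^sup>2 * noise_power k"
proof -
  note AM = sets_history_imp_events[OF A]
  note int = integrable_indicator_mult[OF AM]
  have "expectation (\<lambda>\<omega>. indicator A \<omega> * (norm (mean (drift k \<omega>) - \<theta>))\<^sup>2)
    \<le> expectation (\<lambda>\<omega>. indicator A \<omega> * distance \<theta> k \<omega> - 2 * (indicator A \<omega> * excess \<theta> k \<omega>)
      + spectral_gap / 2 * \<gamma> k * (indicator A \<omega> * disagreement k \<omega>)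
      + error \<theta> k * (indicator A \<omega> * lyapunov \<theta> (\<lambda>i. x k i \<omega>)))"
  proof (rule integral_mono)
    fix \<omega>
    from mult_left_mono[OF norm_mean_drift_le[OF \<gamma>, of \<omega> \<theta>], of "indicator A \<omega>"]
    show "indicator A \<omega> * (norm (mean (drift k \<omega>) - \<theta>))\<^sup>2 \<le> indicator A \<omega> * distance \<theta> k \<omega>
      - 2 * (indicator A \<omega> * excess \<theta> k \<omega>)
      + spectral_gap / 2 * \<gamma> k * (indicator A \<omega> * disagreement k \<omega>)
      + error \<theta> k * (indicator A \<omega> * lyapunov \<theta> (\<lambda>i. x k i \<omega>))"
      by (simp add: algebra_simps)
  qed (intro int integrable_drift Bochner_Integration.integrable_add Bochner_Integration.integrable_diff
      integrable_mult_right integrable_disagreement integrable_distance expectation_lyapunov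
      integrable_excess[OF opt \<gamma>])+
  also have "\<dots> = expectation (\<lambda>\<omega>. indicator A \<omega> * distance \<theta> k \<omega>)
      - 2 * expectation (\<lambda>\<omega>. indicator A \<omega> * excess \<theta> k \<omega>)
      + spectral_gap / 2 * \<gamma> k * expectation (\<lambda>\<omega>. indicator A \<omega> * disagreement k \<omega>)
      + error \<theta> k * expectation (\<lambda>\<omega>. indicator A \<omega> * lyapunov \<theta> (\<lambda>i. x k i \<omega>))"
    using int[OF integrable_disagreement[of k]] int[OF integrable_distance[of \<theta> k]]
      int[OF expectation_lyapunov(1)[of \<theta> k]] int[OF integrable_excess[OF opt \<gamma>]] by simp
  also have "\<dots> \<le> expectation (\<lambda>\<omega>. indicator A \<omega> * distance \<theta> k \<omega>)
      - 2 * expectation (\<lambda>\<omega>. indicator A \<omega> * excess \<theta> k \<omega>)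
      + spectral_gap / 2 * \<gamma> k * expectation (disagreement k)
      + error \<theta> k * level \<theta> k"
  proof (intro add_mono mult_left_mono order_refl)
    show "expectation (\<lambda>\<omega>. indicator A \<omega> * disagreement k \<omega>) \<le> expectation (disagreement k)"
      by (intro indicator_mult_le AM integrable_disagreement disagreement_nonneg)
    show "expectation (\<lambda>\<omega>. indicator A \<omega> * lyapunov \<theta> (\<lambda>i. x k i \<omega>)) \<le> level \<theta> k"
      unfolding expectation_lyapunov(2)[symmetric] using lyapunov_ge(1) order_trans[OF zero_le_one]
      by (intro indicator_mult_le AM expectation_lyapunov) blast
  qed (use spectral_gap gamma_pos[of k] error_nonneg in auto)
  finally have "expectation (\<lambda>\<omega>. indicator A \<omega> * (norm (mean (drift k \<omega>) - \<theta>))\<^sup>2)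
    \<le> expectation (\<lambda>\<omega>. indicator A \<omega> * distance \<theta> k \<omega>)
      - 2 * expectation (\<lambda>\<omega>. indicator A \<omega> * excess \<theta> k \<omega>)
      + spectral_gap / 2 * \<gamma> k * expectation (disagreement k)
      + error \<theta> k * level \<theta> k" .
  moreover have "expectation (\<lambda>\<omega>. indicator A \<omega> * (distance \<theta> (Suc k) \<omega> - distance \<theta> k \<omega>))
    = expectation (\<lambda>\<omega>. indicator A \<omega> * distance \<theta> (Suc k) \<omega>) - expectation (\<lambda>\<omega>. indicator A \<omega> * distance \<theta> k \<omega>)"
    using int[OF integrable_distance] by (simp add: right_diff_distrib)
  ultimately show ?thesis
    using distance_Suc_le[OF A, of \<theta>] by simp
qed


section \<open>Summation over the iterations and almost sure convergence\<close>

lemma expectation_bounds: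
  assumes opt: "optimal_solution (objective f) \<theta>" and K: "\<And>k. k \<ge> K \<Longrightarrow> \<gamma> k \<le> 1"
  shows "\<exists>B. \<forall>k. level \<theta> (k + K) \<le> B"
    and "summable (\<lambda>k. \<gamma> (k + K) * expectation (disagreement (k + K)))"
    and "summable (\<lambda>k. expectation (excess \<theta> (k + K)))"
proof -
  have space: "space M \<in> sets (history k)" for k
    using sets.top[of "history k"] by (simp add: space_history)
  define v d q where "v k = expectation (disagreement k)" and "d k = expectation (distance \<theta> k)"
    and "q k = expectation (excess \<theta> k)" for k
  have nonneg: "0 \<le> v k" "0 \<le> d k" "0 \<le> q k" for k
    by (auto simp: v_def d_def q_def disagreement_nonneg distance_nonneg excess_nonneg[OF opt])
  \<comment> \<open>What is left after adding both inequalities: the contraction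
    \<open>spectral_gap * \<gamma> * v\<close> less the half of it spent on the distance, plus the
    decrease \<open>2 * q\<close>.\<close>
  define w where "w k = spectral_gap / 2 * \<gamma> (k + K) * v (k + K) + 2 * q (k + K)" for k
  define e where "e k = error \<theta> (k + K)" for k
  define n where "n k = (\<gamma> (k + K))\<^sup>2 * noise_power (k + K)" for k
  have e: "0 \<le> e k" and n: "0 \<le> n k" for k
    by (auto simp: e_def n_def error_nonneg noise_power_nonneg)
  have sum_e: "summable e" and sum_n: "summable n"
    unfolding e_def[abs_def] n_def[abs_def] using summable_error summable_noise_power
    by (simp_all add: summable_iff_shift[of "error \<theta>"] summable_iff_shift[of "\<lambda>k. (\<gamma> k)\<^sup>2 * noise_power k"])
  \<comment> \<open>Each of the two inequalities contributes \<open>e k * level\<close>, where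
    \<open>level\<close> is \<open>1 + v + d\<close>. Its constant part joins the additive error and
    the rest becomes the factor \<open>1 + 2 * e k\<close>.\<close>
  have step: "v (Suc k + K) + d (Suc k + K) + w k \<le> (1 + 2 * e k) * (v (k + K) + d (k + K)) + (2 * e k + 2 * n k)" for k
  proof -
    have \<gamma>: "\<gamma> (k + K) \<le> 1" using K by simp
    have full: "expectation (\<lambda>\<omega>. indicator (space M) \<omega> * Y \<omega>) = expectation Y" for Y :: "'w \<Rightarrow> real"
      by (intro Bochner_Integration.integral_cong) auto
    show ?thesis
      using disagreement_drift_le[OF space \<gamma>, of \<theta>] distance_drift_le[OF space \<gamma> opt]
      unfolding full
      by (simp add: v_def d_def q_def w_def e_def n_def level_def integrable_disagreement integrable_distance
          algebra_simps)
  qed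
  have w: "0 \<le> w k" for k
    using nonneg spectral_gap gamma_pos[of "k + K"] by (simp add: w_def)
  have a: "0 \<le> 2 * e k" and b: "0 \<le> 2 * e k + 2 * n k" and u: "0 \<le> v (k + K) + d (k + K)" for k
    using e n nonneg by simp_all
  have sums: "summable (\<lambda>k. 2 * e k)" "summable (\<lambda>k. 2 * e k + 2 * n k)"
    by (intro summable_add summable_mult sum_e sum_n)+
  note bounds = summable_almost_decreasing[of "\<lambda>k. v (k + K) + d (k + K)" w "\<lambda>k. 2 * e k" "\<lambda>k. 2 * e k + 2 * n k",
      OF u w a b sums step]
  have B: "\<exists>B. \<forall>k. v (k + K) + d (k + K) \<le> B" and sum_w: "summable w"
    by (fact bounds)+
  from B obtain B where "\<And>k. v (k + K) + d (k + K) \<le> B" by blast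
  then show "\<exists>B. \<forall>k. level \<theta> (k + K) \<le> B"
    by (intro exI[of _ "1 + B"]) (auto simp: level_def v_def d_def)
  have "summable (\<lambda>k. spectral_gap / 2 * (\<gamma> (k + K) * v (k + K)))"
    by (rule summable_comparison_test'[OF sum_w])
      (use nonneg spectral_gap gamma_pos[THEN less_imp_le] in \<open>auto simp: w_def\<close>)
  then show "summable (\<lambda>k. \<gamma> (k + K) * expectation (disagreement (k + K)))"
    using spectral_gap by (simp add: summable_cmult_iff v_def)
  show "summable (\<lambda>k. expectation (excess \<theta> (k + K)))"
    unfolding q_def[symmetric]
    by (rule summable_comparison_test'[OF sum_w])
      (use nonneg spectral_gap gamma_pos[THEN less_imp_le] in \<open>auto simp: w_def\<close>)
qed

lemma AE_convergence_properties:
  assumes opt: "optimal_solution (objective f) \<theta>"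
  shows "AE \<omega> in M. (\<lambda>k. disagreement k \<omega>) \<longlonglongrightarrow> 0 \<and> convergent (\<lambda>k. distance \<theta> k \<omega>) \<and>
    summable (\<lambda>k. excess \<theta> k \<omega>)"
proof -
  obtain K where K: "\<And>k. k \<ge> K \<Longrightarrow> \<gamma> k \<le> 1"
    using order_tendstoD(2)[OF gamma_lim zero_less_one] by (auto simp: eventually_sequentially intro: less_imp_le)
  note bounds = expectation_bounds[OF opt K]
  obtain B where B: "\<And>k. level \<theta> (k + K) \<le> B" using bounds(1) by blast
  have sum_error: "summable (\<lambda>k. error \<theta> (k + K) * B)"
    using summable_error by (intro summable_mult2) (simp add: summable_iff_shift[of "error \<theta>"])
  have sum_noise: "summable (\<lambda>k. (\<gamma> (k + K))\<^sup>2 * noise_power (k + K))"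
    using summable_noise_power by (simp add: summable_iff_shift[of "\<lambda>k. (\<gamma> k)\<^sup>2 * noise_power k"])
  \<comment> \<open>The uniform bound \<open>B\<close> on \<open>level\<close> makes the errors
    summable numbers, so the two processes can now be treated separately.\<close>
  have err: "error \<theta> (k + K) * level \<theta> (k + K) \<le> error \<theta> (k + K) * B" for k
    by (intro mult_left_mono B error_nonneg)
  interpret V: almost_supermartingale M "\<lambda>k. history (k + K)" "\<lambda>k. disagreement (k + K)"
    "\<lambda>k. error \<theta> (k + K) * B + (\<gamma> (k + K))\<^sup>2 * noise_power (k + K)"
  proof
    fix k A assume A: "A \<in> sets (history (k + K))"
    have "0 \<le> expectation (\<lambda>\<omega>. indicator A \<omega> * disagreement (k + K) \<omega>)"
      by (simp add: disagreement_nonneg)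
    then have "0 \<le> spectral_gap * \<gamma> (k + K) * expectation (\<lambda>\<omega>. indicator A \<omega> * disagreement (k + K) \<omega>)"
      using spectral_gap gamma_pos[of "k + K"] by simp
    then show "expectation (\<lambda>\<omega>. indicator A \<omega> * (disagreement (Suc k + K) \<omega> - disagreement (k + K) \<omega>))
      \<le> error \<theta> (k + K) * B + (\<gamma> (k + K))\<^sup>2 * noise_power (k + K)"
      using disagreement_drift_le[OF A K, of \<theta>] err[of k] by simp
  qed (use history_mono adapted in \<open>auto intro!: subalgebra_history integrable_disagreement disagreement_nonneg
      summable_add sum_error sum_noise\<close>)
  \<comment> \<open>The disagreement term, which the contraction had to compensate before, counts as
    an error here: \<open>bounds(2)\<close> already makes it summable.\<close>
  interpret D: almost_supermartingale M "\<lambda>k. history (k + K)" "\<lambda>k. distance \<theta> (k + K)"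
    "\<lambda>k. spectral_gap / 2 * (\<gamma> (k + K) * expectation (disagreement (k + K)))
      + error \<theta> (k + K) * B + (\<gamma> (k + K))\<^sup>2 * noise_power (k + K)"
  proof
    fix k A assume A: "A \<in> sets (history (k + K))"
    have "0 \<le> expectation (\<lambda>\<omega>. indicator A \<omega> * excess \<theta> (k + K) \<omega>)"
      by (simp add: excess_nonneg[OF opt])
    then show "expectation (\<lambda>\<omega>. indicator A \<omega> * (distance \<theta> (Suc k + K) \<omega> - distance \<theta> (k + K) \<omega>))
      \<le> spectral_gap / 2 * (\<gamma> (k + K) * expectation (disagreement (k + K)))
      + error \<theta> (k + K) * B + (\<gamma> (k + K))\<^sup>2 * noise_power (k + K)"
      using distance_drift_le[OF A K opt] err[of k] by (simp add: mult.assoc)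
  qed (use history_mono adapted in \<open>auto intro!: subalgebra_history integrable_distance distance_nonneg
      summable_add summable_mult bounds(2) sum_error sum_noise\<close>)
  have "AE \<omega> in M. summable (\<lambda>k. \<gamma> (k + K) * disagreement (k + K) \<omega>)"
    using bounds(2) gamma_pos[THEN less_imp_le]
    by (intro AE_summable_if_summable_integral integrable_mult_right integrable_disagreement)
      (auto simp: disagreement_nonneg)
  moreover have "AE \<omega> in M. summable (\<lambda>k. excess \<theta> (k + K) \<omega>)"
    using bounds(3) K
    by (intro AE_summable_if_summable_integral integrable_excess[OF opt]) (auto simp: excess_nonneg[OF opt])
  ultimately show ?thesis
    using V.AE_convergent D.AE_convergent
  proof eventually_elim
    case (elim \<omega>)
    \<comment> \<open>The limit exists by the supermartingale argument, and a positive limit would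
      contradict summability against the non-summable weights \<open>\<gamma>\<close>.\<close>
    have "(\<lambda>k. disagreement (k + K) \<omega>) \<longlonglongrightarrow> 0"
      by (rule tendsto_zero_if_weighted_summable[OF _ elim(1)])
        (use gamma_sum gamma_pos[THEN less_imp_le] elim(3) disagreement_nonneg in \<open>auto simp: summable_iff_shift[of \<gamma>]\<close>)
    then have "(\<lambda>k. disagreement k \<omega>) \<longlonglongrightarrow> 0"
      by (rule LIMSEQ_offset)
    moreover have "convergent (\<lambda>k. distance \<theta> k \<omega>)"
      using elim(4) by (auto simp: convergent_def intro: LIMSEQ_offset)
    moreover have "summable (\<lambda>k. excess \<theta> k \<omega>)"
      using elim(2) by (simp add: summable_iff_shift[of "\<lambda>k. excess \<theta> k \<omega>"])
    ultimately show ?case by blast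
  qed
qed

lemma AE_converges_to_optimal_solution:
  assumes solvable: "\<exists>\<theta>. optimal_solution (objective f) \<theta>"
  shows "AE \<omega> in M. \<exists>\<theta>. optimal_solution (objective f) \<theta> \<and> (\<forall>i. (\<lambda>k. x k i \<omega>) \<longlonglongrightarrow> \<theta>)"
proof -
  obtain \<theta>\<^sub>0 where \<theta>\<^sub>0: "optimal_solution (objective f) \<theta>\<^sub>0" using solvable by blast
  obtain T where T: "countable T" "T \<subseteq> {\<theta>. optimal_solution (objective f) \<theta>}"
    "{\<theta>. optimal_solution (objective f) \<theta>} \<subseteq> closure T"
    using separable by blast
  have "AE \<omega> in M. \<forall>q\<in>T. convergent (\<lambda>k. distance q k \<omega>)"
    using AE_convergence_properties T(2)
    by (subst AE_ball_countable[OF T(1)]) (auto elim!: eventually_mono)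
  with AE_convergence_properties[OF \<theta>\<^sub>0] show ?thesis
  proof eventually_elim
    case (elim \<omega>)
    define z where "z k = mean (\<lambda>i. x k i \<omega>)" for k
    have "\<exists>\<theta>. optimal_solution (objective f) \<theta> \<and> z \<longlonglongrightarrow> \<theta>"
    proof (rule convergent_to_minimiser[OF continuous_objective \<theta>\<^sub>0 T(3)])
      fix q assume "q \<in> T"
      then obtain l where "(\<lambda>k. distance q k \<omega>) \<longlonglongrightarrow> l"
        using elim(2) by (auto simp: convergent_def)
      then have "(\<lambda>k. sqrt (distance q k \<omega>)) \<longlonglongrightarrow> sqrt l"
        by (rule tendsto_real_sqrt)
      then show "convergent (\<lambda>k. dist (z k) q)"
        by (auto simp: distance_def z_def dist_norm convergent_def)
    next
      fix \<epsilon> :: real assume "0 < \<epsilon>"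
      \<comment> \<open>The summable \<open>excess\<close> is the objective gap weighted with the
        non-summable stepsizes, which gives small gaps infinitely often and nothing more.\<close>
      have "\<exists>\<^sub>F k in sequentially. objective f (z k) - objective f \<theta>\<^sub>0 < \<epsilon>"
        using elim(1) lam_nonneg lam_sum \<open>0 < \<epsilon>\<close>
        by (intro frequently_small_if_weighted_summable[of lam]) (auto simp: excess_def z_def)
      then show "\<exists>\<^sub>F k in sequentially. objective f (z k) < objective f \<theta>\<^sub>0 + \<epsilon>"
        by (simp add: algebra_simps)
    qed
    then obtain \<theta> where \<theta>: "optimal_solution (objective f) \<theta>" and lim: "z \<longlonglongrightarrow> \<theta>" by blast
    have "(\<lambda>k. x k i \<omega>) \<longlonglongrightarrow> \<theta>" for i
    proof -
      have "(\<lambda>k. sqrt (disagreement k \<omega>)) \<longlonglongrightarrow> sqrt 0"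
        using elim(1) by (intro tendsto_real_sqrt) blast
      then have "(\<lambda>k. sqrt (disagreement k \<omega>)) \<longlonglongrightarrow> 0" by simp
      \<comment> \<open>The squared deviation of a single agent is one summand of the
        dispersion.\<close>
      moreover have bound: "norm (x k i \<omega> - z k) \<le> sqrt (disagreement k \<omega>)" for k
        unfolding disagreement_def dispersion_def z_def
        by (intro real_le_rsqrt member_le_sum) auto
      ultimately have "(\<lambda>k. x k i \<omega> - z k) \<longlonglongrightarrow> 0"
        by (intro Lim_null_comparison[OF always_eventually[OF allI[OF bound]]])
      from tendsto_add[OF this lim] show ?thesis by simp
    qed
    with \<theta> show ?case by blast
  qed
qed

end

theorem theorem1:
  fixes M :: "'w measure"
    and f :: "'m::finite \<Rightarrow> real ^ 'd \<Rightarrow> real"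
    and g :: "'m \<Rightarrow> real ^ 'd \<Rightarrow> real ^ 'd"
    and W :: "real ^ 'm ^ 'm"
    and \<gamma> lam :: "nat \<Rightarrow> real"
    and \<sigma> :: "nat \<Rightarrow> 'm \<Rightarrow> real"
    and \<zeta> x :: "nat \<Rightarrow> 'm \<Rightarrow> 'w \<Rightarrow> real ^ 'd"
    and L :: real
  assumes prob: "prob_space M"
    and grad: "\<And>i u. GDERIV (f i) u :> g i u"
    and coupling: "coupling_matrix W"
    and gamma_pos: "\<And>k. \<gamma> k > 0"
    and gamma_decreasing: "decseq \<gamma>"
    and gamma_lim: "\<gamma> \<longlonglongrightarrow> 0"
    and algorithm: "static_consensus M W \<gamma> lam g \<zeta> x"
    and solvable: "\<exists>\<theta>. optimal_solution (objective f) \<theta>"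
    and convex: "convex_on UNIV (objective f)"
    and L_pos: "L > 0"
    and grad_lipschitz: "\<And>i u v. norm (g i u - g i v) \<le> L * norm (u - v)"
    and W_sym: "transpose W = W"
    and W_cols: "1 v* W = 0"
    and W_rows: "W *v 1 = 0"
    and W_norm: "onorm ((*v) (mat 1 + W - avg_matrix)) < 1"
    and noise: "noise_moments M x \<zeta> \<sigma>"
    and noise_past: "noise_memoryless M x \<zeta>"
    and noise_summable: "summable (\<lambda>k. (\<gamma> k)\<^sup>2 * (MAX i. (\<sigma> k i)\<^sup>2))"
    and init_measurable: "\<And>i. x 0 i \<in> borel_measurable M"
    and init_moment: "\<And>i. integrable M (\<lambda>\<omega>. (norm (x 0 i \<omega>))\<^sup>2)"
    and lam_nonneg: "\<And>k. lam k \<ge> 0"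
    and gamma_sum: "\<not> summable \<gamma>"
    and lam_sum: "\<not> summable lam"
    and ratio_sum: "summable (\<lambda>k. (lam k)\<^sup>2 / \<gamma> k)"
  shows "AE \<omega> in M. \<exists>\<theta>. optimal_solution (objective f) \<theta> \<and> (\<forall>i. (\<lambda>k. x k i \<omega>) \<longlonglongrightarrow> \<theta>)"
proof -
  have "square_integrable M (x 0 i)" for i
    using init_measurable init_moment by (simp add: square_integrable_def)
  then interpret consensus_run M f g W L \<gamma> lam \<sigma> \<zeta> x
    using assms by (intro consensus_run.intro consensus_problem.intro consensus_run_axioms.intro)
  show ?thesis
    using solvable by (rule AE_converges_to_optimal_solution)
qed

end
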